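(* Let $p\in(0,\infty)\setminus\mathbb{N}$, $\ell:=\lceil p-1\rceil$, and let $X$ be a real random variable with $\mathsf{E}\, X_+^p<\infty$. Then the following two conditions are equivalent: (I) $\mathsf{E}|X|^\ell<\infty$ and \[ \mathsf{E}\, X_+^p=\frac{\Gamma(p+1)}{\pi}\int_{0+}^\infty\operatorname{Re}\frac{\mathsf{E}\, e_\ell(itX)}{(it)^{p+1}}\,dt, \] where $\int_{0+}^\infty$ denotes $\lim_{v\downarrow0}\int_v^\infty$ (the integrals over $[v,\infty)$ taken in the Lebesgue sense); (II) $\mathsf{P}(X_->x)=o(x^{-p})$ as $x\to\infty$.
   Context: $x_+:=\max(0,x)$, $x_-:=\max(0,-x)$, $x_+^p:=(x_+)^p$. For complex $z$, $e_\ell(z):=e^z-\sum_{j=0}^\ell z^j/j!$. For $t>0$, $(it)^{p+1}:=t^{p+1}e^{i\pi(p+1)/2}$ (principal branch). *)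

theory Defs
  imports "HOL-Probability.Probability" "HOL-Library.Landau_Symbols"
begin

definition exp_rem :: "nat \<Rightarrow> complex \<Rightarrow> complex" where
  "exp_rem l z = exp z - (\<Sum>j\<le>l. z ^ j / of_nat (fact j))"

text \<open>(i t)^(p+1) := t^(p+1) * exp(i pi (p+1)/2) for t > 0 (principal branch)\<close>
definition it_pow :: "real \<Rightarrow> real \<Rightarrow> complex" where
  "it_pow p t = complex_of_real (t powr (p + 1)) * cis (pi * (p + 1) / 2)"

end

theory Submission
  imports Defs
begin

text \<open>
  Write \<open>p = l + a\<close> with \<open>0 < a < 1\<close>, split \<open>X = X\<^sub>+ - X\<^sub>-\<close>, and let \<open>T v x\<close> be the integral of
  \<open>Re (e\<^sub>l (i t x) / (i t)\<^bsup>p+1\<^esup>)\<close> over \<open>t > v\<close>. By Fubini the truncated integral in (I) is \<open>E T v X\<close>,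
  and \<open>T v x = v\<^bsup>-p\<^esup> T 1 (v x)\<close> by scaling. A Laplace transform evaluates \<open>T 0\<close> for \<open>p < 1\<close>; since
  \<open>d/dx\<close> lowers \<open>p\<close> and \<open>l\<close> by one, \<open>T 0 x = \<pi> / \<Gamma>(p+1) x\<^sub>+\<^bsup>p\<^esup>\<close> for all \<open>p\<close>. Dominated
  convergence disposes of \<open>X\<^sub>+\<close>, so that (I) says \<open>v\<^bsup>-p\<^esup> E g (v X\<^sub>-) \<rightarrow> 0\<close> as \<open>v\<close> decreases to zero, for
  the weight \<open>g x = (-1)\<^bsup>l\<^esup> T 1 (-x)\<close>.

  This weight is nonnegative and bounded away from zero at infinity, so Markov's inequality gives
  (II). Conversely \<open>g x \<le> C min(x\<^bsup>l\<^esup>, x\<^bsup>l+1\<^esup>)\<close>, and the layer cake formula turns (II) into the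
  limit.
\<close>

section \<open>Integration and differentiation\<close>

lemma
  fixes f :: "'a::euclidean_space \<Rightarrow> real"
  assumes "(f has_integral I) A" and "\<And>x. x \<in> A \<Longrightarrow> 0 \<le> f x"
    and "set_borel_measurable lborel A f"
  shows set_integrable_of_has_integral_nonneg: "set_integrable lborel A f"
    and set_integral_of_has_integral_nonneg: "(LINT x:A|lborel. f x) = I"
proof -
  have "has_bochner_integral lborel (\<lambda>x. indicator A x * f x) I"
    using assms nn_integral_has_integral_lebesgue[OF assms(2,1)] has_integral_nonneg[OF assms(1,2)]
    by (intro has_bochner_integral_nn_integral)
       (auto simp: set_borel_measurable_def indicator_def)
  then show "set_integrable lborel A f" "(LINT x:A|lborel. f x) = I"
    by (simp_all add: set_integrable_def set_lebesgue_integral_def has_bochner_integral_iff)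
qed

lemma set_integrable_lborel_atLeast:
  fixes f :: "real \<Rightarrow> 'a::{banach, second_countable_topology}"
  shows "set_integrable lborel {v..} f \<longleftrightarrow> set_integrable lborel {v<..} f"
  by (rule set_integrable_discrete_difference[of "{v}"]) auto

lemma set_integral_lborel_atLeast:
  fixes f :: "real \<Rightarrow> 'a::{banach, second_countable_topology}"
  shows "(LINT t:{v..}|lborel. f t) = (LINT t:{v<..}|lborel. f t)"
  by (rule set_integral_discrete_difference[of "{v}"]) auto

lemma
  fixes f :: "real \<Rightarrow> 'a::{banach, second_countable_topology}"
  assumes "c > 0"
  shows set_integrable_greaterThan_affine:
      "set_integrable lborel {d + c * v<..} f \<longleftrightarrow> set_integrable lborel {v<..} (\<lambda>t. f (d + c * t))"
    and set_integral_greaterThan_affine: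
      "(LINT t:{d + c * v<..}|lborel. f t) = c *\<^sub>R (LINT t:{v<..}|lborel. f (d + c * t))"
proof -
  have "indicat_real {d + c * v<..} (d + c * t) = indicator {v<..} t" for t
    using assms by (simp add: indicator_def)
  then show "set_integrable lborel {d + c * v<..} f
      \<longleftrightarrow> set_integrable lborel {v<..} (\<lambda>t. f (d + c * t))"
    and "(LINT t:{d + c * v<..}|lborel. f t) = c *\<^sub>R (LINT t:{v<..}|lborel. f (d + c * t))"
    using assms
      lborel_integrable_real_affine_iff[of c "\<lambda>t. indicator {d + c * v<..} t *\<^sub>R f t" d]
      lborel_integral_real_affine[of c "\<lambda>t. indicator {d + c * v<..} t *\<^sub>R f t" d]
    by (simp_all add: set_integrable_def set_lebesgue_integral_def)
qed

lemma set_integral_greaterThan_split: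
  fixes f :: "real \<Rightarrow> 'a::{banach, second_countable_topology}"
  assumes "set_integrable lborel {v<..} f" "v \<le> w"
  shows "(LINT t:{v<..}|lborel. f t) = (LINT t:{v<..w}|lborel. f t) + (LINT t:{w<..}|lborel. f t)"
proof -
  have "(LINT t:{v<..w} \<union> {w<..}|lborel. f t)
      = (LINT t:{v<..w}|lborel. f t) + (LINT t:{w<..}|lborel. f t)"
    using assms(2) by (intro set_integral_Un set_integrable_subset[OF assms(1)]) auto
  also have "{v<..w} \<union> {w<..} = {v<..}"
    using assms(2) by auto
  finally show ?thesis .
qed

lemma set_integral_FTC_greaterThan:
  fixes f F :: "real \<Rightarrow> real"
  assumes "\<And>x. v < x \<Longrightarrow> (F has_real_derivative f x) (at x)" and "\<And>x. v < x \<Longrightarrow> isCont f x"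
    and "set_integrable lborel {v<..} f"
    and "isCont F v" and "(F \<longlongrightarrow> L) at_top"
  shows "(LINT x:{v<..}|lborel. f x) = L - F v"
proof -
  have "(LBINT x=ereal v..\<infinity>. f x) = L - F v"
    using assms
    by (intro interval_integral_FTC_integrable)
       (auto simp: has_real_derivative_iff_has_vector_derivative[symmetric] ereal_tendsto_simps1
          isCont_def filterlim_at_split)
  then show ?thesis
    by (simp add: interval_integral_to_infinity_eq)
qed

lemma integral_dominated_convergence_within:
  fixes s :: "'b::first_countable_topology \<Rightarrow> 'a \<Rightarrow> 'c::{banach, second_countable_topology}"
  assumes [measurable]: "f \<in> borel_measurable M" "\<And>y. s y \<in> borel_measurable M"
    and w: "integrable M w"
    and lim: "AE \<omega> in M. ((\<lambda>y. s y \<omega>) \<longlongrightarrow> f \<omega>) (at x within A)"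
    and bound: "\<forall>\<^sub>F y in at x within A. AE \<omega> in M. norm (s y \<omega>) \<le> w \<omega>"
  shows "((\<lambda>y. integral\<^sup>L M (s y)) \<longlongrightarrow> integral\<^sup>L M f) (at x within A)"
  unfolding tendsto_at_iff_sequentially
proof (intro allI impI)
  fix S :: "nat \<Rightarrow> 'b"
  assume "\<forall>n. S n \<in> A - {x}" and "S \<longlonglongrightarrow> x"
  then have S: "filterlim S (at x within A) sequentially"
    by (auto simp: filterlim_at)
  obtain N where N: "\<And>n. n \<ge> N \<Longrightarrow> AE \<omega> in M. norm (s (S n) \<omega>) \<le> w \<omega>"
    using eventually_compose_filterlim[OF bound S] by (auto simp: eventually_sequentially)
  have "(\<lambda>n. integral\<^sup>L M (s (S (n + N)))) \<longlonglongrightarrow> integral\<^sup>L M f"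
  proof (rule integral_dominated_convergence)
    show "AE \<omega> in M. (\<lambda>n. s (S (n + N)) \<omega>) \<longlonglongrightarrow> f \<omega>"
      using lim
      by eventually_elim (rule LIMSEQ_ignore_initial_segment, rule filterlim_compose[OF _ S])
  qed (use w N in auto)
  then show "((\<lambda>y. integral\<^sup>L M (s y)) \<circ> S) \<longlonglongrightarrow> integral\<^sup>L M f"
    unfolding comp_def by (rule LIMSEQ_offset)
qed

lemma has_real_derivative_pos_part_powr:
  fixes x q :: real
  assumes "x \<noteq> 0"
  shows "((\<lambda>x. max 0 x powr q) has_real_derivative q * max 0 x powr (q - 1)) (at x)"
proof (cases "x > 0")
  case True
  have "((\<lambda>x. x powr q) has_real_derivative q * max 0 x powr (q - 1)) (at x)"
    using True by (auto intro!: derivative_eq_intros)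
  then show ?thesis
    by (rule has_field_derivative_transform_within_open[of _ _ _ "{0<..}"]) (use True in auto)
next
  case False
  have "((\<lambda>x. 0) has_real_derivative q * max 0 x powr (q - 1)) (at x)"
    using False by auto
  then show ?thesis
    by (rule has_field_derivative_transform_within_open[of _ _ _ "{..<0}"])
       (use assms False in auto)
qed

lemma has_real_derivative_integral:
  fixes f f' :: "real \<Rightarrow> 'a \<Rightarrow> real"
  assumes f: "\<And>y. integrable M (f y)" and [measurable]: "f' x \<in> borel_measurable M"
    and r: "r > 0" and deriv: "\<And>y \<omega>. dist y x < r \<Longrightarrow> \<omega> \<in> space M \<Longrightarrow>
      ((\<lambda>y. f y \<omega>) has_real_derivative f' y \<omega>) (at y)"
    and w: "integrable M w"
    and bound: "\<And>y \<omega>. dist y x < r \<Longrightarrow> \<omega> \<in> space M \<Longrightarrow> \<bar>f' y \<omega>\<bar> \<le> w \<omega>"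
  shows "((\<lambda>y. integral\<^sup>L M (f y)) has_real_derivative integral\<^sup>L M (f' x)) (at x)"
proof -
  let ?quot = "\<lambda>y \<omega>. (f y \<omega> - f x \<omega>) / (y - x)"
  have [measurable]: "f y \<in> borel_measurable M" for y
    using f by auto
  have quot_bound: "\<bar>?quot y \<omega>\<bar> \<le> w \<omega>" if "dist y x < r" "y \<noteq> x" "\<omega> \<in> space M" for y \<omega>
  proof -
    have "norm (f y \<omega> - f x \<omega>) \<le> w \<omega> * norm (y - x)"
    proof (rule field_differentiable_bound[where S = "ball x r"])
      show "((\<lambda>y. f y \<omega>) has_field_derivative f' z \<omega>) (at z within ball x r)"
        if "z \<in> ball x r" for z
        by (rule has_field_derivative_at_within[OF deriv])
           (use that \<open>\<omega> \<in> space M\<close> in \<open>auto simp: dist_commute\<close>)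
      show "norm (f' z \<omega>) \<le> w \<omega>" if "z \<in> ball x r" for z
        using that bound[of z \<omega>] \<open>\<omega> \<in> space M\<close> by (simp add: dist_commute)
    qed (use that r in \<open>auto simp: dist_commute\<close>)
    then show ?thesis
      using that(2) by (simp add: divide_simps)
  qed
  have "((\<lambda>y. integral\<^sup>L M (?quot y)) \<longlongrightarrow> integral\<^sup>L M (f' x)) (at x)"
  proof (rule integral_dominated_convergence_within)
    show "AE \<omega> in M. ((\<lambda>y. ?quot y \<omega>) \<longlongrightarrow> f' x \<omega>) (at x)"
      using deriv[of x] r by (intro AE_I2) (simp add: has_field_derivative_iff)
    show "\<forall>\<^sub>F y in at x. AE \<omega> in M. norm (?quot y \<omega>) \<le> w \<omega>"
      using quot_bound r by (auto simp: eventually_at intro!: exI[of _ r])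
  qed (use w in auto)
  also have "(\<lambda>y. integral\<^sup>L M (?quot y))
      = (\<lambda>y. (integral\<^sup>L M (f y) - integral\<^sup>L M (f x)) / (y - x))"
    using f by simp
  finally show ?thesis
    by (simp add: has_field_derivative_iff)
qed

lemma (in pair_sigma_finite) integrable_mult_pair:
  fixes f :: "'a \<Rightarrow> real" and g :: "'b \<Rightarrow> real"
  assumes "integrable M1 f" "integrable M2 g"
  shows "integrable (M1 \<Otimes>\<^sub>M M2) (\<lambda>(x, y). f x * g y)"
proof -
  have [measurable]: "f \<in> borel_measurable M1" "g \<in> borel_measurable M2"
    using assms by auto
  show ?thesis
    using assms by (intro Fubini_integrable) (auto simp: abs_mult)
qed

lemma (in sigma_finite_measure) nn_integral_layer_cake:
  fixes Y :: "'a \<Rightarrow> real" and \<psi> :: "real \<Rightarrow> ennreal"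
  assumes [measurable]: "Y \<in> borel_measurable M" "\<psi> \<in> borel_measurable borel"
  shows "(\<integral>\<^sup>+\<omega>. (\<integral>\<^sup>+s\<in>{..<Y \<omega>}. \<psi> s \<partial>lborel) \<partial>M)
    = (\<integral>\<^sup>+s. \<psi> s * emeasure M {\<omega> \<in> space M. s < Y \<omega>} \<partial>lborel)"
proof -
  interpret pair_sigma_finite M lborel ..
  have "(\<integral>\<^sup>+\<omega>. (\<integral>\<^sup>+s\<in>{..<Y \<omega>}. \<psi> s \<partial>lborel) \<partial>M)
      = (\<integral>\<^sup>+\<omega>. (\<integral>\<^sup>+s. \<psi> s * indicator {(\<omega>, s). s < Y \<omega>} (\<omega>, s) \<partial>lborel) \<partial>M)"
    by (simp add: indicator_def)
  also have "\<dots> = (\<integral>\<^sup>+s. (\<integral>\<^sup>+\<omega>. \<psi> s * indicator {(\<omega>, s). s < Y \<omega>} (\<omega>, s) \<partial>M) \<partial>lborel)"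
    by (rule Fubini'[symmetric]) measurable
  also have "\<dots> = (\<integral>\<^sup>+s. (\<integral>\<^sup>+\<omega>. \<psi> s * indicator {\<omega> \<in> space M. s < Y \<omega>} \<omega> \<partial>M) \<partial>lborel)"
    by (intro nn_integral_cong) (simp add: indicator_def)
  finally show ?thesis
    by (simp add: nn_integral_cmult_indicator)
qed

lemma set_integral_single_crossing_nonneg:
  fixes f w :: "real \<Rightarrow> real"
  assumes f: "set_integrable M A f" and wf: "set_integrable M A (\<lambda>u. w u * f u)"
    and w: "antimono_on A w" and m: "m \<in> A" "0 \<le> w m"
    and before: "\<And>u. u \<in> A \<Longrightarrow> u \<le> m \<Longrightarrow> 0 \<le> f u" and after: "\<And>u. u \<in> A \<Longrightarrow> m \<le> u \<Longrightarrow> f u \<le> 0"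
    and "0 \<le> (LINT u:A|M. f u)"
  shows "0 \<le> (LINT u:A|M. w u * f u)"
proof -
  have "0 \<le> w m * (LINT u:A|M. f u)"
    using assms by simp
  also have "\<dots> = (LINT u:A|M. w m * f u)"
    by simp
  also have "\<dots> \<le> (LINT u:A|M. w u * f u)"
  proof (rule set_integral_mono)
    fix u assume u: "u \<in> A"
    show "w m * f u \<le> w u * f u"
    proof (cases "u \<le> m")
      case True
      then show ?thesis
        using u m(1) w before by (intro mult_right_mono) (auto dest: monotone_onD)
    next
      case False
      then show ?thesis
        using u m(1) w after by (intro mult_right_mono_neg) (auto dest: monotone_onD)
    qed
  qed (use f wf in auto)
  finally show ?thesis .
qed

section \<open>Gamma and Laplace integrals\<close>

lemma
  fixes y a :: real
  assumes "0 < y" "0 < a" "a < 1"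
  shows set_integrable_min_mult_powr:
      "set_integrable lborel {0<..} (\<lambda>t. min 1 (y * t) * t powr (- a - 1))"
    and set_integral_min_mult_powr:
      "(LINT t:{0<..}|lborel. min 1 (y * t) * t powr (- a - 1)) = y powr a / (a * (1 - a))"
proof -
  let ?f = "\<lambda>t. min 1 (y * t) * t powr (- a - 1)"
  define c where "c = 1 / y"
  have "c > 0"
    using assms by (simp add: c_def)
  have "((\<lambda>t. y * t powr (- a)) has_integral y * (c powr (- a + 1) / (- a + 1))) {0..c}"
    using assms \<open>c > 0\<close> by (intro has_integral_mult_right has_integral_powr_from_0) auto
  then have low: "(?f has_integral y * (c powr (- a + 1) / (- a + 1))) {0..c}"
    by (rule has_integral_eq[rotated])
       (use assms in \<open>auto simp: c_def field_simps min_def powr_diff powr_minus\<close>)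
  have "((\<lambda>t. t powr (- a - 1)) has_integral - (c powr (- a - 1 + 1)) / (- a - 1 + 1)) {c..}"
    using assms \<open>c > 0\<close> by (intro has_integral_powr_to_inf) auto
  then have high: "(?f has_integral - (c powr (- a - 1 + 1)) / (- a - 1 + 1)) {c..}"
    by (rule has_integral_eq[rotated]) (use assms in \<open>auto simp: c_def field_simps min_def\<close>)
  have "(?f has_integral y * (c powr (- a + 1) / (- a + 1)) +
      - (c powr (- a - 1 + 1)) / (- a - 1 + 1))
      ({0..c} \<union> {c..})"
    using \<open>c > 0\<close>
    by (intro has_integral_Un[OF low high] negligible_subset[OF negligible_sing[of c]]) auto
  also have "{0..c} \<union> {c..} = {0..}"
    using \<open>c > 0\<close> by auto
  also have "y * (c powr (- a + 1) / (- a + 1)) + - (c powr (- a - 1 + 1)) / (- a - 1 + 1)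
      = y powr a / (1 - a) + y powr a / a"
    using assms by (simp add: c_def powr_divide powr_diff powr_minus_divide)
  also have "\<dots> = y powr a / (a * (1 - a))"
    using assms by (simp add: divide_simps) (simp add: algebra_simps)
  finally have "(?f has_integral y powr a / (a * (1 - a))) {0..}" .
  then have "set_integrable lborel {0..} ?f"
    "(LINT t:{0..}|lborel. ?f t) = y powr a / (a * (1 - a))"
    using assms
    by (auto intro!: set_integrable_of_has_integral_nonneg set_integral_of_has_integral_nonneg
        simp: set_borel_measurable_def)
  then show "set_integrable lborel {0<..} ?f"
    and "(LINT t:{0<..}|lborel. ?f t) = y powr a / (a * (1 - a))"
    by (simp_all only: set_integrable_lborel_atLeast set_integral_lborel_atLeast)
qed

lemma
  fixes v e :: real
  assumes "0 < v" "e < - 1"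
  shows set_integrable_powr_greaterThan: "set_integrable lborel {v<..} (\<lambda>t. t powr e)"
    and set_integral_powr_greaterThan:
      "(LINT t:{v<..}|lborel. t powr e) = - (v powr (e + 1)) / (e + 1)"
  unfolding set_integrable_lborel_atLeast[symmetric] set_integral_lborel_atLeast[symmetric]
  using has_integral_powr_to_inf[OF assms(2,1)]
  by (auto intro!: set_integrable_of_has_integral_nonneg set_integral_of_has_integral_nonneg
      simp: set_borel_measurable_def)

lemma
  fixes v e :: real and f :: "real \<Rightarrow> real"
  assumes v: "0 < v" and e: "e < - 1" and [measurable]: "f \<in> borel_measurable borel"
    and f: "\<And>t. \<bar>f t\<bar> \<le> 1"
  shows set_integrable_powr_mult_bounded: "set_integrable lborel {v<..} (\<lambda>t. t powr e * f t)"
    and abs_set_integral_powr_mult_bounded_le: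
      "\<bar>LINT t:{v<..}|lborel. t powr e * f t\<bar> \<le> - (v powr (e + 1)) / (e + 1)"
proof -
  note powr = set_integrable_powr_greaterThan[OF v e]
  show int: "set_integrable lborel {v<..} (\<lambda>t. t powr e * f t)"
    using powr by (rule set_integrable_bound)
      (use f in \<open>auto simp: set_borel_measurable_def abs_mult mult_left_le\<close>)
  have "\<bar>LINT t:{v<..}|lborel. t powr e * f t\<bar> \<le> (LINT t:{v<..}|lborel. \<bar>t powr e * f t\<bar>)"
    using set_integral_norm_bound[OF int] by simp
  also have "\<dots> \<le> (LINT t:{v<..}|lborel. t powr e)"
    using f
    by (intro set_integral_mono set_integrable_abs int powr) (simp add: abs_mult mult_left_le)
  also have "\<dots> = - (v powr (e + 1)) / (e + 1)"
    using v e by (rule set_integral_powr_greaterThan)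
  finally show "\<bar>LINT t:{v<..}|lborel. t powr e * f t\<bar> \<le> - (v powr (e + 1)) / (e + 1)" .
qed

lemma
  fixes q c :: real
  assumes "q > 0" "c > 0"
  shows set_integrable_powr_exp:
      "set_integrable lborel {0<..} (\<lambda>t. t powr (q - 1) * exp (- (c * t)))"
    and set_integral_powr_exp:
      "(LINT t:{0<..}|lborel. t powr (q - 1) * exp (- (c * t))) = Gamma q * c powr (- q)"
proof -
  let ?f = "\<lambda>t. t powr (q - 1) * exp (- t)"
  have "(?f has_integral Gamma q) {0..}"
    using Gamma_integral_real[OF assms(1)] by (simp add: exp_minus divide_inverse)
  then have Gamma: "set_integrable lborel {0<..} ?f" "(LINT t:{0<..}|lborel. ?f t) = Gamma q"
    unfolding set_integrable_lborel_atLeast[symmetric] set_integral_lborel_atLeast[symmetric]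
    by (auto intro!: set_integrable_of_has_integral_nonneg set_integral_of_has_integral_nonneg
        simp: set_borel_measurable_def)
  have f_scale: "t powr (q - 1) * exp (- (c * t)) = c powr (1 - q) * ?f (c * t)" if "t > 0" for t
    using that assms by (simp add: powr_mult powr_diff)
  have "set_integrable lborel {0<..} (\<lambda>t. ?f (c * t))"
    using Gamma(1) set_integrable_greaterThan_affine[OF assms(2), of 0 0 ?f] by simp
  then show "set_integrable lborel {0<..} (\<lambda>t. t powr (q - 1) * exp (- (c * t)))"
    by (subst set_integrable_cong[OF refl refl f_scale]) auto
  have "(LINT t:{0<..}|lborel. t powr (q - 1) * exp (- (c * t)))
      = (LINT t:{0<..}|lborel. c powr (1 - q) * ?f (c * t))"
    using f_scale by (intro set_lebesgue_integral_cong) auto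
  also have "\<dots> = c powr (1 - q) * (LINT t:{0<..}|lborel. ?f (c * t))"
    by (rule set_integral_mult_right)
  also have "(LINT t:{0<..}|lborel. ?f (c * t)) = Gamma q / c"
    using Gamma(2) set_integral_greaterThan_affine[OF assms(2), of 0 0 ?f] assms
    by (simp add: eq_divide_eq mult.commute)
  finally show "(LINT t:{0<..}|lborel. t powr (q - 1) * exp (- (c * t))) = Gamma q * c powr (- q)"
    using assms by (simp add: powr_diff powr_minus field_simps)
qed

definition laplace_transform :: "(real \<Rightarrow> real) \<Rightarrow> real \<Rightarrow> real" where
  "laplace_transform f u = (LINT s:{0<..}|lborel. exp (- (u * s)) * f s)"

lemma
  fixes f :: "real \<Rightarrow> real"
  assumes q: "q > 0" and a: "a \<ge> 0" and [measurable]: "f \<in> borel_measurable borel"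
    and f: "set_integrable lborel {0<..} (\<lambda>s. (s + a) powr (- q) * f s)"
  shows set_integrable_powr_laplace_transform:
      "set_integrable lborel {0<..} (\<lambda>u. u powr (q - 1) * exp (- (a * u)) * laplace_transform f u)"
    and set_integral_powr_laplace_transform:
      "(LINT u:{0<..}|lborel. u powr (q - 1) * exp (- (a * u)) * laplace_transform f u)
       = Gamma q * (LINT s:{0<..}|lborel. (s + a) powr (- q) * f s)"
proof -
  let ?F = "\<lambda>s u. indicator {0<..} s *
      (indicator {0<..} u * (u powr (q - 1) * exp (- ((s + a) * u))) * f s)"
  have inner: "set_integrable lborel {0<..} (\<lambda>u. u powr (q - 1) * exp (- ((s + a) * u)))"
    "(LINT u:{0<..}|lborel. u powr (q - 1) * exp (- ((s + a) * u))) = Gamma q * (s + a) powr (- q)"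
    if "s > 0" for s
    using set_integrable_powr_exp[OF q, of "s + a"] set_integral_powr_exp[OF q, of "s + a"] that a
    by auto
  have inner_u: "(\<integral>u. ?F s u \<partial>lborel) = Gamma q * (indicator {0<..} s * ((s + a) powr (- q) * f s))"
    for s
    using inner(2)[of s] by (cases "s > 0") (simp_all add: set_lebesgue_integral_def)
  have inner_s: "(\<integral>s. ?F s u \<partial>lborel)
      = indicator {0<..} u * (u powr (q - 1) * exp (- (a * u)) * laplace_transform f u)" for u
  proof -
    have "?F s u = indicator {0<..} u * (u powr (q - 1) * exp (- (a * u)))
        * (indicator {0<..} s * (exp (- (u * s)) * f s))" for s
      by (simp add: exp_add[symmetric] algebra_simps)
    then show ?thesis
      by (simp only: integral_mult_right_zero laplace_transform_def set_lebesgue_integral_def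
          real_scaleR_def mult.assoc)
  qed
  have int: "integrable (lborel \<Otimes>\<^sub>M lborel) (case_prod ?F)"
  proof (rule lborel_pair.Fubini_integrable)
    have "(\<integral>u. norm (?F s u) \<partial>lborel) = Gamma q * \<bar>indicator {0<..} s * ((s + a) powr (- q) * f s)\<bar>"
      for s
      using inner(2)[of s] by (cases "s > 0") (simp_all add: abs_mult set_lebesgue_integral_def)
    then show "integrable lborel (\<lambda>s. \<integral>u. norm (case_prod ?F (s, u)) \<partial>lborel)"
      using f by (simp add: set_integrable_def)
    show "AE s in lborel. integrable lborel (\<lambda>u. case_prod ?F (s, u))"
      using inner(1) by (intro AE_I2) (auto simp: set_integrable_def indicator_def)
  qed measurable
  show "set_integrable lborel {0<..} (\<lambda>u. u powr (q - 1) * exp (- (a * u)) * laplace_transform f u)"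
    using lborel_pair.integrable_snd[OF int] by (simp add: inner_s set_integrable_def)
  show "(LINT u:{0<..}|lborel. u powr (q - 1) * exp (- (a * u)) * laplace_transform f u)
       = Gamma q * (LINT s:{0<..}|lborel. (s + a) powr (- q) * f s)"
    using lborel_pair.Fubini_integral[OF int, unfolded inner_u inner_s]
    by (simp add: set_lebesgue_integral_def)
qed

lemma Gamma_reflection_real:
  fixes x :: real
  shows "Gamma x * Gamma (1 - x) = pi / sin (pi * x)"
proof -
  have "complex_of_real (Gamma x * Gamma (1 - x)) = complex_of_real (pi / sin (pi * x))"
    using Gamma_reflection_complex[of "of_real x"]
    by (simp add: Gamma_complex_of_real[symmetric] sin_of_real[symmetric])
  then show ?thesis
    by (simp only: of_real_eq_iff)
qed

lemma
  fixes q :: real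
  assumes q: "0 < q" "q < 1"
  shows set_integrable_powr_over_one_plus:
      "set_integrable lborel {0<..} (\<lambda>t. t powr (q - 1) / (1 + t))"
    and set_integral_powr_over_one_plus:
      "(LINT t:{0<..}|lborel. t powr (q - 1) / (1 + t)) = pi / sin (pi * q)"
proof -
  let ?f = "\<lambda>t. t powr (q - 1)"
  have f: "set_integrable lborel {0<..} (\<lambda>t. (t + 1) powr (- 1) * ?f t)"
  proof (rule set_integrable_bound)
    show "set_integrable lborel {0<..} (\<lambda>t. min 1 (1 * t) * t powr (- (1 - q) - 1))"
      using q by (intro set_integrable_min_mult_powr) auto
    have "(t + 1) powr (- 1) * ?f t \<le> min 1 t * t powr (q - 2)" if "t > 0" for t
    proof -
      have "?f t = t * t powr (q - 2)"
        using that by (simp add: powr_mult_base)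
      then have "(t + 1) powr (- 1) * ?f t = t / (1 + t) * t powr (q - 2)"
        using that by (simp add: powr_minus_divide add.commute)
      also have "\<dots> \<le> min 1 t * t powr (q - 2)"
        using that by (intro mult_right_mono) (auto simp: field_simps)
      finally show ?thesis .
    qed
    then show "AE t in lborel. t \<in> {0<..} \<longrightarrow> norm ((t + 1) powr (- 1) * ?f t)
        \<le> norm (min 1 (1 * t) * t powr (- (1 - q) - 1))"
      by (intro AE_I2) simp
  qed (simp add: set_borel_measurable_def)
  have f_eq: "(t + 1) powr (- 1) * ?f t = t powr (q - 1) / (1 + t)" if "t \<in> {0<..}" for t
    using that by (simp add: powr_minus field_simps)
  show "set_integrable lborel {0<..} (\<lambda>t. t powr (q - 1) / (1 + t))"
    by (rule iffD1[OF set_integrable_cong f]) (use f_eq in auto)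
  have "(LINT t:{0<..}|lborel. t powr (q - 1) / (1 + t))
      = (LINT t:{0<..}|lborel. (t + 1) powr (- 1) * ?f t)"
    by (intro set_lebesgue_integral_cong allI impI f_eq[symmetric]) auto
  also have "\<dots> = (LINT u:{0<..}|lborel. u powr (1 - 1) * exp (- (1 * u)) * laplace_transform ?f u)"
    using set_integral_powr_laplace_transform[OF zero_less_one zero_le_one _ f] by simp
  also have "\<dots> = (LINT u:{0<..}|lborel. Gamma q * (u powr ((1 - q) - 1) * exp (- (1 * u))))"
    using set_integral_powr_exp[OF q(1)]
    by (intro set_lebesgue_integral_cong) (auto simp: laplace_transform_def mult_ac)
  also have "\<dots> = Gamma q * Gamma (1 - q)"
    using set_integral_powr_exp[of "1 - q" 1] q by simp
  finally show "(LINT t:{0<..}|lborel. t powr (q - 1) / (1 + t)) = pi / sin (pi * q)"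
    by (simp only: Gamma_reflection_real)
qed

lemma
  fixes q :: real
  assumes q: "0 < q" "q < 2"
  shows set_integrable_powr_over_one_plus_square:
      "set_integrable lborel {0<..} (\<lambda>t. t powr (q - 1) / (1 + t\<^sup>2))"
    and set_integral_powr_over_one_plus_square:
      "(LINT t:{0<..}|lborel. t powr (q - 1) / (1 + t\<^sup>2)) = pi / (2 * sin (pi * q / 2))"
proof -
  let ?f = "\<lambda>t::real. t powr (q / 2 - 1) / (1 + t)" and ?g = "\<lambda>t. t powr (q - 1) / (1 + t\<^sup>2)"
  have "?f integrable_on {0<..}" "integral {0<..} ?f = pi / sin (pi * (q / 2))"
    using set_borel_integral_eq_integral[OF set_integrable_powr_over_one_plus[of "q / 2"]]
      set_integral_powr_over_one_plus[of "q / 2"] q by auto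
  then have "?f absolutely_integrable_on {0<..}" "integral {0<..} ?f = pi / sin (pi * (q / 2))"
    by (auto intro!: nonnegative_absolutely_integrable_1)
  moreover have "power2 ` {0<..} = ({0<..} :: real set)"
  proof -
    have "x \<in> power2 ` {0<..}" if "x > 0" for x :: real
      using that by (intro image_eqI[of _ _ "sqrt x"]) auto
    then show ?thesis
      by auto
  qed
  moreover have "(power2 has_real_derivative 2 * t) (at t within {0<..})" for t :: real
    by (auto intro!: derivative_eq_intros)
  moreover have "inj_on power2 ({0<..} :: real set)"
    by (auto intro!: inj_onI)
  ultimately have "(\<lambda>t. \<bar>2 * t\<bar> * ?f (t\<^sup>2)) integrable_on {0<..}"
    "integral {0<..} (\<lambda>t. \<bar>2 * t\<bar> * ?f (t\<^sup>2)) = pi / sin (pi * (q / 2))"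
    using has_absolute_integral_change_of_variables_1'
        [of "{0<..}" power2 "\<lambda>t. 2 * t" ?f "pi / sin (pi * (q / 2))"]
    by (auto simp: absolutely_integrable_on_def)
  then have "((\<lambda>t. \<bar>2 * t\<bar> * ?f (t\<^sup>2)) has_integral pi / sin (pi * (q / 2))) {0<..}"
    by (simp add: has_integral_iff)
  then have "((\<lambda>t. \<bar>2 * t\<bar> * ?f (t\<^sup>2) / 2) has_integral pi / sin (pi * (q / 2)) / 2) {0<..}"
    by (rule has_integral_divide)
  moreover have "\<bar>2 * t\<bar> * ?f (t\<^sup>2) / 2 = ?g t" if "t \<in> {0<..}" for t
  proof -
    have "t\<^sup>2 powr (q / 2) = t powr q"
      using that by (simp add: powr_numeral[symmetric] powr_powr del: powr_numeral)
    then show ?thesis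
      using that by (simp add: powr_diff power2_eq_square)
  qed
  ultimately have "(?g has_integral pi / sin (pi * (q / 2)) / 2) {0<..}"
    by (rule has_integral_eq[rotated])
  then show "set_integrable lborel {0<..} ?g"
    and "(LINT t:{0<..}|lborel. ?g t) = pi / (2 * sin (pi * q / 2))"
    by (auto intro!: set_integrable_of_has_integral_nonneg set_integral_of_has_integral_nonneg
        simp: set_borel_measurable_def mult.commute)
qed

section \<open>Sine integrals\<close>

definition sin_drop :: "real \<Rightarrow> real \<Rightarrow> real" where
  "sin_drop \<phi> s = sin \<phi> - sin (s + \<phi>)"

lemma sin_drop_measurable [measurable]: "sin_drop \<phi> \<in> borel_measurable borel"
  unfolding sin_drop_def[abs_def] by measurable

lemma sin_drop_minus: "sin_drop (- \<phi>) (- s) = - sin_drop \<phi> s"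
  using sin_minus[of "s + \<phi>"] by (simp add: sin_drop_def)

lemma sin_drop_eq_mult: "sin_drop \<phi> s = - (2 * sin (s / 2) * cos (s / 2 + \<phi>))"
  using sin_diff_sin[of "s + \<phi>" \<phi>] by (simp add: sin_drop_def add_divide_distrib add.commute)

lemma sin_drop_periodic: "sin_drop \<phi> (s + 2 * pi * real k) = sin_drop \<phi> s"
proof -
  have "sin (s + \<phi> + 2 * pi * real k) = sin (s + \<phi>)"
    using sin_2npi[of k] cos_2npi[of k] by (simp add: sin_add[of "s + \<phi>"] mult_ac)
  then show ?thesis
    by (simp add: sin_drop_def add_ac)
qed

lemma sin_drop_nonpos:
  assumes "0 \<le> s" "s \<le> pi - 2 * \<phi>" "0 \<le> \<phi>"
  shows "sin_drop \<phi> s \<le> 0"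
proof -
  have "0 \<le> sin (s / 2)" "0 \<le> cos (s / 2 + \<phi>)"
    using assms by (auto intro!: sin_ge_zero cos_ge_zero)
  then show ?thesis
    by (simp add: sin_drop_eq_mult)
qed

lemma sin_drop_nonneg:
  assumes "pi - 2 * \<phi> \<le> s" "0 \<le> s" "s \<le> 2 * pi" "\<phi> \<le> pi / 2"
  shows "0 \<le> sin_drop \<phi> s"
proof -
  have "0 \<le> sin (s / 2)"
    using assms by (intro sin_ge_zero) auto
  moreover have "0 \<le> cos (s / 2 + \<phi> - pi)"
    using assms by (intro cos_ge_zero; linarith)
  ultimately show ?thesis
    by (simp add: sin_drop_eq_mult cos_diff mult_nonneg_nonpos)
qed

lemma abs_sin_drop_le: "\<bar>sin_drop \<phi> s\<bar> \<le> 2 * min 1 \<bar>s\<bar>"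
proof -
  have "\<bar>sin (s / 2)\<bar> \<le> min 1 \<bar>s\<bar>"
    using abs_sin_x_le_abs_x[of "s / 2"] by simp
  then have "\<bar>sin (s / 2)\<bar> * \<bar>cos (s / 2 + \<phi>)\<bar> \<le> min 1 \<bar>s\<bar> * 1"
    by (intro mult_mono) auto
  then show ?thesis
    by (simp add: sin_drop_eq_mult abs_mult)
qed

lemma set_integrable_exp_sin_drop:
  assumes "u > 0"
  shows "set_integrable lborel {0<..} (\<lambda>s. exp (- (u * s)) * sin_drop \<phi> s)"
proof (rule set_integrable_bound)
  show "set_integrable lborel {0<..} (\<lambda>s. 2 * exp (- (s * u)))"
    using integrable_I0i_exp_mscale[OF assms] by simp
  have "exp (- (u * s)) * \<bar>sin_drop \<phi> s\<bar> \<le> exp (- (u * s)) * 2" for s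
    using abs_sin_drop_le[of \<phi> s] by (intro mult_left_mono) auto
  then show "AE s in lborel. s \<in> {0<..} \<longrightarrow> norm (exp (- (u * s)) * sin_drop \<phi> s)
      \<le> norm (2 * exp (- (s * u)))"
    by (simp add: abs_mult mult.commute)
qed (simp add: set_borel_measurable_def)

lemma tendsto_exp_mult_bounded:
  fixes f :: "real \<Rightarrow> real"
  assumes "u > 0" and bound: "\<And>s. \<bar>f s\<bar> \<le> B"
  shows "((\<lambda>s. exp (- (u * s)) * f s) \<longlongrightarrow> 0) at_top"
proof (rule Lim_null_comparison)
  show "\<forall>\<^sub>F s in at_top. norm (exp (- (u * s)) * f s) \<le> exp (- (u * s)) * B"
    using bound by (intro always_eventually allI) (simp add: abs_mult)
  have "filterlim (\<lambda>s. u * s) at_top at_top"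
    using assms(1) by (intro filterlim_tendsto_pos_mult_at_top[OF tendsto_const _ filterlim_ident])
  then show "((\<lambda>s. exp (- (u * s)) * B) \<longlongrightarrow> 0) at_top"
    by (intro tendsto_mult_left_zero exp_at_bot[THEN filterlim_compose])
       (simp add: filterlim_uminus_at_bot)
qed

lemma laplace_transform_sin_drop:
  assumes u: "u > 0"
  shows "laplace_transform (sin_drop \<phi>) u = (sin \<phi> - u * cos \<phi>) / (u * (u\<^sup>2 + 1))"
proof -
  have u1: "u\<^sup>2 + 1 \<noteq> 0"
    using zero_le_power2[of u] by linarith
  define k where "k = 1 / (u\<^sup>2 + 1)"
  have k: "0 \<le> k" "k * (u\<^sup>2 + 1) = 1"
    using u1 by (auto simp: k_def)
  let ?F = "\<lambda>s. exp (- (u * s)) * (k * (u * sin (s + \<phi>) + cos (s + \<phi>)) - sin \<phi> / u)"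
  have deriv: "(?F has_real_derivative exp (- (u * s)) * sin_drop \<phi> s) (at s)" for s
  proof -
    have "(?F has_real_derivative
        exp (- (u * s)) * (sin \<phi> - k * (u\<^sup>2 + 1) * sin (s + \<phi>))) (at s)"
      using u by (auto intro!: derivative_eq_intros simp: algebra_simps power2_eq_square)
    then show ?thesis
      by (simp only: k sin_drop_def mult_1)
  qed
  have "\<bar>k * (u * sin (s + \<phi>) + cos (s + \<phi>)) - sin \<phi> / u\<bar> \<le> k * (u + 1) + 1 / u" for s
  proof -
    have "\<bar>u * sin (s + \<phi>) + cos (s + \<phi>)\<bar> \<le> u * 1 + 1"
      using u by (intro order.trans[OF abs_triangle_ineq] add_mono) (auto simp: abs_mult)
    then have "\<bar>k * (u * sin (s + \<phi>) + cos (s + \<phi>))\<bar> \<le> k * (u + 1)"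
      using k by (simp add: abs_mult mult_left_mono)
    moreover have "\<bar>sin \<phi> / u\<bar> \<le> 1 / u"
      using u by (simp add: divide_right_mono)
    ultimately show ?thesis
      by linarith
  qed
  with u have "(?F \<longlongrightarrow> 0) at_top"
    by (rule tendsto_exp_mult_bounded)
  then have "laplace_transform (sin_drop \<phi>) u = 0 - ?F 0"
    unfolding laplace_transform_def using deriv u
    by (intro set_integral_FTC_greaterThan set_integrable_exp_sin_drop)
       (auto simp: sin_drop_def[abs_def] intro!: continuous_intros DERIV_isCont[OF deriv])
  also have "\<dots> = (sin \<phi> - u * cos \<phi>) / (u * (u\<^sup>2 + 1))"
    using u u1 by (simp add: k_def divide_simps) (simp add: algebra_simps power2_eq_square)
  finally show ?thesis .
qed

lemma set_integrable_powr_sin_drop: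
  fixes \<phi> a b :: real
  assumes a: "0 < a" "a < 1" and b: "b \<ge> 0"
  shows "set_integrable lborel {0<..} (\<lambda>s. (s + b) powr (- a - 1) * sin_drop \<phi> s)"
proof (rule set_integrable_bound)
  show "set_integrable lborel {0<..} (\<lambda>s. 2 * (min 1 (1 * s) * s powr (- a - 1)))"
    using a by (intro set_integrable_mult_right set_integrable_min_mult_powr) auto
  have "(s + b) powr (- a - 1) * \<bar>sin_drop \<phi> s\<bar> \<le> s powr (- a - 1) * (2 * min 1 s)" if "s > 0" for s
    using that a b abs_sin_drop_le[of \<phi> s] by (intro mult_mono powr_mono2') auto
  then show "AE s in lborel. s \<in> {0<..} \<longrightarrow> norm ((s + b) powr (- a - 1) * sin_drop \<phi> s)
      \<le> norm (2 * (min 1 (1 * s) * s powr (- a - 1)))"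
    by (intro AE_I2) (auto simp: abs_mult mult_ac)
qed (simp add: set_borel_measurable_def)

lemma
  fixes a b \<phi> :: real
  assumes a: "0 < a" "a < 1" and b: "b \<ge> 0"
  shows set_integrable_powr_laplace_sin_drop: "set_integrable lborel {0<..}
      (\<lambda>u. u powr a * exp (- (b * u)) * laplace_transform (sin_drop \<phi>) u)"
    and set_integral_powr_laplace_sin_drop:
      "(LINT u:{0<..}|lborel. u powr a * exp (- (b * u)) * laplace_transform (sin_drop \<phi>) u)
       = Gamma (a + 1) * (LINT s:{0<..}|lborel. (s + b) powr (- a - 1) * sin_drop \<phi> s)"
proof -
  have "set_integrable lborel {0<..} (\<lambda>s. (s + b) powr (- (a + 1)) * sin_drop \<phi> s)"
    using set_integrable_powr_sin_drop[OF a b] by simp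
  then show "set_integrable lborel {0<..}
      (\<lambda>u. u powr a * exp (- (b * u)) * laplace_transform (sin_drop \<phi>) u)"
    and "(LINT u:{0<..}|lborel. u powr a * exp (- (b * u)) * laplace_transform (sin_drop \<phi>) u)
       = Gamma (a + 1) * (LINT s:{0<..}|lborel. (s + b) powr (- a - 1) * sin_drop \<phi> s)"
    using a b set_integrable_powr_laplace_transform[of "a + 1" b "sin_drop \<phi>"]
      set_integral_powr_laplace_transform[of "a + 1" b "sin_drop \<phi>"]
    by simp_all
qed

lemma set_integral_powr_sin_drop:
  fixes a \<phi> :: real
  assumes a: "0 < a" "a < 1"
  shows "(LINT s:{0<..}|lborel. s powr (- a - 1) * sin_drop \<phi> s)
    = pi / (2 * Gamma (a + 1)) * (sin \<phi> / sin (pi * a / 2) - cos \<phi> / cos (pi * a / 2))"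
proof -
  let ?f = "\<lambda>u. sin \<phi> * (u powr (a - 1) / (1 + u\<^sup>2))"
    and ?g = "\<lambda>u. cos \<phi> * (u powr ((a + 1) - 1) / (1 + u\<^sup>2))"
  have "u powr a * laplace_transform (sin_drop \<phi>) u = ?f u - ?g u" if "u > 0" for u
  proof -
    have "u powr a = u * u powr (a - 1)"
      using that by (simp add: powr_mult_base)
    then show ?thesis
      using that by (simp add: laplace_transform_sin_drop add.commute)
        (simp add: right_diff_distrib diff_divide_distrib mult_ac)
  qed
  then have "(LINT u:{0<..}|lborel. u powr a * laplace_transform (sin_drop \<phi>) u)
      = (LINT u:{0<..}|lborel. ?f u - ?g u)"
    by (intro set_lebesgue_integral_cong) auto
  also have "\<dots> = (LINT u:{0<..}|lborel. ?f u) - (LINT u:{0<..}|lborel. ?g u)"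
    using a
    by (intro set_integral_diff set_integrable_mult_right set_integrable_powr_over_one_plus_square)
       auto
  also have "\<dots> = sin \<phi> * (pi / (2 * sin (pi * a / 2)))
      - cos \<phi> * (pi / (2 * sin (pi * (a + 1) / 2)))"
    unfolding set_integral_mult_right using a
    by (subst (1 2) set_integral_powr_over_one_plus_square) auto
  also have "sin (pi * (a + 1) / 2) = cos (pi * a / 2)"
    by (simp add: add_divide_distrib distrib_left sin_add)
  finally have "(LINT u:{0<..}|lborel. u powr a * laplace_transform (sin_drop \<phi>) u)
      = pi / 2 * (sin \<phi> / sin (pi * a / 2) - cos \<phi> / cos (pi * a / 2))"
    by (simp add: algebra_simps)
  moreover have "Gamma (a + 1) > 0"
    using a by (intro Gamma_real_pos) auto
  ultimately show ?thesis
    using set_integral_powr_laplace_sin_drop[OF a order.refl, of \<phi>] by (simp add: field_simps)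
qed

lemma laplace_transform_sin_drop_sign:
  assumes "u > 0" "cos \<phi> > 0"
  shows "u \<le> tan \<phi> \<Longrightarrow> 0 \<le> laplace_transform (sin_drop \<phi>) u"
    and "tan \<phi> \<le> u \<Longrightarrow> laplace_transform (sin_drop \<phi>) u \<le> 0"
  using assms
  by (auto simp: laplace_transform_sin_drop tan_def field_simps
      intro!: divide_nonneg_pos divide_nonpos_pos add_nonneg_pos)

text \<open>
  For \<open>b = 0\<close> the integral vanishes. On the Laplace side the shift by \<open>b\<close> is the decreasing weight
  \<open>exp (- b u)\<close>, and the Laplace transform of \<open>sin_drop\<close> changes sign only once, from plus to minus.
\<close>

lemma set_integral_shifted_powr_sin_drop_nonneg:
  fixes a b :: real
  assumes a: "0 < a" "a < 1" and b: "b \<ge> 0"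
  defines "\<theta> \<equiv> pi * a / 2"
  shows "0 \<le> (LINT s:{0<..}|lborel. (s + b) powr (- a - 1) * sin_drop \<theta> s)"
proof -
  have \<theta>: "0 < \<theta>" "\<theta> < pi / 2"
    using a by (auto simp: \<theta>_def)
  then have cos: "cos \<theta> > 0" and tan: "tan \<theta> > 0"
    by (auto intro: cos_gt_zero tan_gt_zero)
  let ?f = "\<lambda>u. u powr a * laplace_transform (sin_drop \<theta>) u"
  have "0 \<le> (LINT u:{0<..}|lborel. exp (- (b * u)) * ?f u)"
  proof (rule set_integral_single_crossing_nonneg)
    show "set_integrable lborel {0<..} ?f"
      using set_integrable_powr_laplace_sin_drop[OF a order.refl] by simp
    show "set_integrable lborel {0<..} (\<lambda>u. exp (- (b * u)) * ?f u)"
      using set_integrable_powr_laplace_sin_drop[OF a b] by (simp add: mult_ac)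
    show "antimono_on {0<..} (\<lambda>u. exp (- (b * u)))"
      using b by (auto intro!: monotone_onI mult_left_mono)
    show "tan \<theta> \<in> {0<..}" "0 \<le> exp (- (b * tan \<theta>))"
      using tan by auto
    show "0 \<le> ?f u" if "u \<in> {0<..}" "u \<le> tan \<theta>" for u
      using that cos laplace_transform_sin_drop_sign(1) by simp
    show "?f u \<le> 0" if "u \<in> {0<..}" "tan \<theta> \<le> u" for u
      using that cos laplace_transform_sin_drop_sign(2) by (simp add: mult_nonneg_nonpos)
    show "0 \<le> (LINT u:{0<..}|lborel. ?f u)"
      using set_integral_powr_laplace_sin_drop[OF a order.refl, of \<theta>]
        set_integral_powr_sin_drop[OF a, of \<theta>] cos sin_gt_zero[of \<theta>] \<theta>
      by (simp flip: \<theta>_def)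
  qed
  then have "0 \<le> Gamma (a + 1) * (LINT s:{0<..}|lborel. (s + b) powr (- a - 1) * sin_drop \<theta> s)"
    using set_integral_powr_laplace_sin_drop[OF a b, of \<theta>] by (simp add: mult_ac)
  moreover have "Gamma (a + 1) > 0"
    using a by (intro Gamma_real_pos) auto
  ultimately show ?thesis
    by (simp add: zero_le_mult_iff)
qed

lemma abs_set_integral_powr_sin_le:
  fixes a v \<phi> :: real
  assumes a: "a > 0" and v: "v > 0"
  shows "\<bar>LINT t:{v<..}|lborel. t powr (- a - 1) * sin (t + \<phi>)\<bar> \<le> 2 * v powr (- a - 1)"
proof -
  have sin: "set_integrable lborel {v<..} (\<lambda>t. t powr (- a - 1) * sin (t + \<phi>))"
    and cos: "set_integrable lborel {v<..} (\<lambda>t. t powr (- a - 2) * cos (t + \<phi>))"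
    using a v by (auto intro!: set_integrable_powr_mult_bounded)
  let ?I = "LINT t:{v<..}|lborel. t powr (- a - 1) * sin (t + \<phi>)"
  let ?J = "LINT t:{v<..}|lborel. t powr (- a - 2) * cos (t + \<phi>)"
  let ?f = "\<lambda>t. t powr (- a - 1) * sin (t + \<phi>) + (a + 1) * (t powr (- a - 2) * cos (t + \<phi>))"
    and ?F = "\<lambda>t. - (t powr (- a - 1) * cos (t + \<phi>))"
  have "?I + (a + 1) * ?J = (LINT t:{v<..}|lborel. ?f t)"
    using sin cos by simp
  also have "\<dots> = 0 - ?F v"
  proof (rule set_integral_FTC_greaterThan)
    show "(?F has_real_derivative ?f t) (at t)" if "v < t" for t
      using that v by (auto intro!: derivative_eq_intros simp: algebra_simps)
    show "(?F \<longlongrightarrow> 0) at_top"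
    proof (rule Lim_null_comparison)
      show "\<forall>\<^sub>F t in at_top. norm (?F t) \<le> t powr (- a - 1)"
        by (intro always_eventually allI) (simp add: abs_mult mult_left_le)
      show "((\<lambda>t. t powr (- a - 1)) \<longlongrightarrow> 0) at_top"
        using a by (intro tendsto_neg_powr filterlim_ident) auto
    qed
  qed (use v sin cos in \<open>auto intro!: continuous_intros\<close>)
  finally have "?I = v powr (- a - 1) * cos (v + \<phi>) - (a + 1) * ?J"
    by simp
  moreover have "\<bar>v powr (- a - 1) * cos (v + \<phi>)\<bar> \<le> v powr (- a - 1)"
    by (simp add: abs_mult mult_left_le)
  moreover have "\<bar>(a + 1) * ?J\<bar> \<le> v powr (- a - 1)"
  proof -
    have "\<bar>?J\<bar> \<le> - (v powr (- a - 2 + 1)) / (- a - 2 + 1)"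
      using a v by (intro abs_set_integral_powr_mult_bounded_le) auto
    also have "\<dots> = v powr (- a - 1) / (a + 1)"
      by (simp add: minus_divide_right minus_diff_commute[of 1 a])
    finally show ?thesis
      using a by (simp add: abs_mult le_divide_eq mult.commute)
  qed
  ultimately show ?thesis
    by linarith
qed

lemma set_integral_powr_sin_drop_ge:
  fixes a v \<phi> :: real
  assumes a: "a > 0" and v: "v > 0"
  shows "sin \<phi> / a * v powr (- a) - 2 * v powr (- a - 1)
    \<le> (LINT t:{v<..}|lborel. t powr (- a - 1) * sin_drop \<phi> t)"
proof -
  have powr: "set_integrable lborel {v<..} (\<lambda>t. t powr (- a - 1))"
    using a v by (intro set_integrable_powr_greaterThan) auto
  have sin: "set_integrable lborel {v<..} (\<lambda>t. t powr (- a - 1) * sin (t + \<phi>))"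
    using a v by (intro set_integrable_powr_mult_bounded) auto
  have "(LINT t:{v<..}|lborel. t powr (- a - 1) * sin_drop \<phi> t)
      = (LINT t:{v<..}|lborel. sin \<phi> * t powr (- a - 1) - t powr (- a - 1) * sin (t + \<phi>))"
    by (simp add: sin_drop_def algebra_simps)
  also have "\<dots> = sin \<phi> * (v powr (- a) / a)
      - (LINT t:{v<..}|lborel. t powr (- a - 1) * sin (t + \<phi>))"
    using powr sin a v by (simp add: set_integral_powr_greaterThan)
  finally show ?thesis
    using abs_set_integral_powr_sin_le[OF a v, of \<phi>] by simp
qed

lemma set_integral_powr_sin_drop_nonneg_multiple_2pi:
  fixes a :: real
  assumes a: "0 < a" "a < 1"
  shows "0 \<le> (LINT t:{2 * pi * real k<..}|lborel. t powr (- a - 1) * sin_drop (pi * a / 2) t)"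
  using set_integral_greaterThan_affine
      [of 1 "2 * pi * real k" 0 "\<lambda>t. t powr (- a - 1) * sin_drop (pi * a / 2) t"]
    set_integral_shifted_powr_sin_drop_nonneg[OF a, of "2 * pi * real k"]
  by (simp add: sin_drop_periodic[of _ _ k] add.commute[of "2 * pi * real k"])

text \<open>
  Between two consecutive multiples of \<open>2\<pi>\<close> the function \<open>sin_drop \<theta>\<close> is first negative and then
  positive, so over a period the integral over \<open>{v<..}\<close> is smallest at an end point.
\<close>

lemma set_integral_powr_sin_drop_nonneg:
  fixes a v :: real
  assumes a: "0 < a" "a < 1" and v: "v \<ge> 0"
  defines "\<theta> \<equiv> pi * a / 2"
  shows "0 \<le> (LINT t:{v<..}|lborel. t powr (- a - 1) * sin_drop \<theta> t)"
proof -
  have \<theta>: "0 < \<theta>" "\<theta> < pi / 2"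
    using a by (auto simp: \<theta>_def)
  note multiple = set_integral_powr_sin_drop_nonneg_multiple_2pi[OF a, folded \<theta>_def]
  define k where "k = nat \<lfloor>v / (2 * pi)\<rfloor>"
  define c where "c = 2 * pi * real k"
  have "real k \<le> v / (2 * pi)" "v / (2 * pi) < real (Suc k)"
    using v by (auto simp: k_def) linarith
  then have c: "0 \<le> c" "c \<le> v" "v < c + 2 * pi" "c + 2 * pi = 2 * pi * real (Suc k)"
    by (auto simp: c_def field_simps)
  have shift: "sin_drop \<theta> t = sin_drop \<theta> (t - c)" for t
    using sin_drop_periodic[of \<theta> "t - c" k] by (simp add: c_def)
  have int: "set_integrable lborel {s<..} (\<lambda>t. t powr (- a - 1) * sin_drop \<theta> t)" if "s \<ge> 0" for s
    by (rule set_integrable_subset[OF set_integrable_powr_sin_drop[OF a order.refl, simplified]])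
       (use that in auto)
  show ?thesis
  proof (cases "v - c \<le> pi - 2 * \<theta>")
    case True
    then have "sin_drop \<theta> t \<le> 0" if "t \<in> {c<..v}" for t
      using that \<theta> shift[of t] by (auto intro!: sin_drop_nonpos)
    then have "(LINT t:{c<..v}|lborel. t powr (- a - 1) * sin_drop \<theta> t)
        \<le> (\<integral>t. 0 \<partial>(lborel :: real measure))"
      unfolding set_lebesgue_integral_def
      by (intro integral_mono') (auto simp: indicator_def mult_nonneg_nonpos)
    then show ?thesis
      using set_integral_greaterThan_split[OF int[OF c(1)] c(2)] multiple[of k] by (simp add: c_def)
  next
    case False
    then have "0 \<le> sin_drop \<theta> t" if "t \<in> {v<..c + 2 * pi}" for t
      using that \<theta> shift[of t] by (auto intro!: sin_drop_nonneg)
    then have "0 \<le> (LINT t:{v<..c + 2 * pi}|lborel. t powr (- a - 1) * sin_drop \<theta> t)"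
      unfolding set_lebesgue_integral_def
      by (intro Bochner_Integration.integral_nonneg) (auto simp: indicator_def)
    then show ?thesis
      using set_integral_greaterThan_split[OF int[OF v] less_imp_le[OF c(3)]]
        multiple[of "Suc k"] c(4)
      by simp
  qed
qed

section \<open>The inversion kernel\<close>

definition inversion_kernel :: "real \<Rightarrow> nat \<Rightarrow> real \<Rightarrow> real \<Rightarrow> real" where
  "inversion_kernel a l t x = Re (exp_rem l (\<i> * complex_of_real (t * x)) / it_pow (real l + a) t)"

definition inversion_integral :: "real \<Rightarrow> nat \<Rightarrow> real \<Rightarrow> real \<Rightarrow> real" where
  "inversion_integral a l v x = (LINT t:{v<..}|lborel. inversion_kernel a l t x)"

lemma exp_rem_measurable [measurable]: "exp_rem l \<in> borel_measurable borel"
  unfolding exp_rem_def[abs_def] by measurable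

lemma it_pow_measurable [measurable]: "it_pow p \<in> borel_measurable borel"
  unfolding it_pow_def[abs_def] by measurable

lemma inversion_kernel_measurable [measurable]:
  assumes [measurable]: "f \<in> borel_measurable M" "g \<in> borel_measurable M"
  shows "(\<lambda>w. inversion_kernel a l (f w) (g w)) \<in> borel_measurable M"
proof -
  have [measurable]: "Re \<in> borel_measurable borel"
    by (intro borel_measurable_continuous_onI continuous_intros)
  show ?thesis
    unfolding inversion_kernel_def by measurable
qed

lemma inversion_integral_measurable [measurable]:
  "inversion_integral a l v \<in> borel_measurable borel"
  unfolding inversion_integral_def[abs_def] set_lebesgue_integral_def by measurable

lemma norm_exp_rem_le: "norm (exp_rem l (\<i> * complex_of_real y)) \<le> 2 * \<bar>y\<bar> ^ l * min 1 \<bar>y\<bar>"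
proof -
  have "norm (exp_rem l (\<i> * complex_of_real y)) \<le> 2 * \<bar>y\<bar> ^ l / fact l"
    using iexp_approx2[of y l] by (simp add: exp_rem_def)
  also have "\<dots> \<le> 2 * \<bar>y\<bar> ^ l"
    by (simp add: divide_le_eq mult_le_cancel_left1 fact_ge_1)
  finally have large: "norm (exp_rem l (\<i> * complex_of_real y)) \<le> 2 * \<bar>y\<bar> ^ l" .
  have "norm (exp_rem l (\<i> * complex_of_real y)) \<le> \<bar>y\<bar> ^ Suc l / fact (Suc l)"
    using iexp_approx1[of y l] by (simp add: exp_rem_def)
  also have "\<dots> \<le> \<bar>y\<bar> ^ Suc l"
    by (simp add: divide_le_eq mult_le_cancel_left1 fact_ge_1 del: fact_Suc power_Suc)
  also have "\<dots> \<le> 2 * \<bar>y\<bar> ^ l * \<bar>y\<bar>"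
    by simp
  finally show ?thesis
    using large by (simp add: min_def)
qed

lemma exp_rem_0 [simp]: "exp_rem l 0 = 0"
  using norm_exp_rem_le[of l 0] by simp

lemma inversion_kernel_0 [simp]: "inversion_kernel a l t 0 = 0"
  by (simp add: inversion_kernel_def)

lemma inversion_integral_0 [simp]: "inversion_integral a l v 0 = 0"
  by (simp add: inversion_integral_def)

lemma abs_inversion_kernel_le:
  assumes "t > 0"
  shows "\<bar>inversion_kernel a l t x\<bar> \<le> 2 * \<bar>x\<bar> ^ l * (min 1 (\<bar>x\<bar> * t) * t powr (- a - 1))"
proof -
  have "\<bar>inversion_kernel a l t x\<bar>
      \<le> norm (exp_rem l (\<i> * complex_of_real (t * x)) / it_pow (real l + a) t)"
    unfolding inversion_kernel_def by (rule abs_Re_le_cmod)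
  also have "\<dots> = norm (exp_rem l (\<i> * complex_of_real (t * x))) / t powr (real l + a + 1)"
    by (simp add: norm_divide it_pow_def norm_mult)
  also have "\<dots> \<le> 2 * \<bar>t * x\<bar> ^ l * min 1 \<bar>t * x\<bar> / t powr (real l + a + 1)"
    by (intro divide_right_mono norm_exp_rem_le) simp
  also have "\<dots> = 2 * \<bar>x\<bar> ^ l * min 1 (\<bar>x\<bar> * t) * (t ^ l / t powr (real l + a + 1))"
    using assms by (simp add: abs_mult power_mult_distrib mult_ac)
  also have "t ^ l / t powr (real l + a + 1) = t powr (- a - 1)"
    using assms by (simp add: powr_realpow[symmetric] powr_diff[symmetric])
  finally show ?thesis
    by (simp only: mult.assoc)
qed

lemma inversion_kernel_scale:
  assumes "c > 0" "t > 0"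
  shows "inversion_kernel a l t (c * x) = c powr (real l + a + 1) * inversion_kernel a l (c * t) x"
proof -
  have "it_pow (real l + a) (c * t) = of_real (c powr (real l + a + 1)) * it_pow (real l + a) t"
    using assms by (simp add: it_pow_def powr_mult)
  then have "exp_rem l (\<i> * complex_of_real (t * (c * x))) / it_pow (real l + a) t
      = c powr (real l + a + 1) *\<^sub>R
        (exp_rem l (\<i> * complex_of_real (c * t * x)) / it_pow (real l + a) (c * t))"
    using assms by (simp add: scaleR_conv_of_real mult_ac)
  then show ?thesis
    unfolding inversion_kernel_def by (simp only: scaleR_complex.simps)
qed

lemma inversion_integral_scale:
  assumes "c > 0" "v \<ge> 0"
  shows "inversion_integral a l v (c * x) = c powr (real l + a) * inversion_integral a l (c * v) x"
proof -
  have "inversion_integral a l v (c * x)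
      = (LINT t:{v<..}|lborel. c powr (real l + a + 1) * inversion_kernel a l (c * t) x)"
    unfolding inversion_integral_def using assms
    by (intro set_lebesgue_integral_cong) (auto simp: inversion_kernel_scale)
  then show ?thesis
    using assms set_integral_greaterThan_affine[of c 0 v "\<lambda>t. inversion_kernel a l t x"]
    by (simp add: inversion_integral_def powr_add)
qed

lemma inversion_kernel_order_0:
  "inversion_kernel a 0 t x = - (t powr (- a - 1) * sin_drop (- (pi * a / 2)) (t * x))"
proof -
  define \<theta> where "\<theta> = pi * a / 2"
  have angle: "pi * (a + 1) / 2 = \<theta> + pi / 2"
    by (simp add: \<theta>_def field_simps)
  have "exp_rem 0 (\<i> * complex_of_real (t * x)) = cis (t * x) - cis 0"
    by (simp add: exp_rem_def cis_conv_exp)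
  then have "exp_rem 0 (\<i> * complex_of_real (t * x)) / it_pow a t
      = inverse (t powr (a + 1)) *\<^sub>R ((cis (t * x) - cis 0) / cis (\<theta> + pi / 2))"
    unfolding it_pow_def angle scaleR_conv_of_real of_real_inverse
    by (simp only: divide_inverse inverse_mult_distrib mult_ac)
  also have "(cis (t * x) - cis 0) / cis (\<theta> + pi / 2)
      = cis (t * x - \<theta> - pi / 2) - cis (- \<theta> - pi / 2)"
    by (simp only: diff_divide_distrib cis_divide) (simp add: diff_diff_eq)
  finally have "inversion_kernel a 0 t x
      = inverse (t powr (a + 1)) * Re (cis (t * x - \<theta> - pi / 2) - cis (- \<theta> - pi / 2))"
    by (simp only: inversion_kernel_def scaleR_complex.simps of_nat_0 add_0)
  also have "Re (cis (t * x - \<theta> - pi / 2) - cis (- \<theta> - pi / 2)) = - sin_drop (- \<theta>) (t * x)"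
    by (simp add: sin_drop_def cos_diff)
  also have "inverse (t powr (a + 1)) = t powr (- a - 1)"
    unfolding powr_minus[symmetric] by simp
  finally show ?thesis
    by (simp add: \<theta>_def)
qed

lemma it_pow_Suc:
  assumes "t > 0"
  shows "it_pow (p + 1) t = \<i> * of_real t * it_pow p t"
proof -
  have "pi * (p + 1 + 1) / 2 = pi / 2 + pi * (p + 1) / 2"
    by (simp add: field_simps)
  then have "cis (pi * (p + 1 + 1) / 2) = \<i> * cis (pi * (p + 1) / 2)"
    by (simp only: cis_mult[symmetric] cis_pi_half)
  moreover have "t powr (p + 1 + 1) = t * t powr (p + 1)"
    using assms by (simp only: powr_add[of t "p + 1"]) simp
  ultimately show ?thesis
    by (simp only: it_pow_def of_real_mult) simp
qed

lemma exp_rem_has_field_derivative: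
  "(exp_rem (Suc l) has_field_derivative exp_rem l z) (at z)"
proof -
  have "((\<lambda>z. exp z - (\<Sum>j\<le>Suc l. z ^ j / of_nat (fact j))) has_field_derivative
      exp z - (\<Sum>j\<le>Suc l. of_nat j * z ^ (j - 1) / of_nat (fact j))) (at z)"
    by (auto intro!: derivative_eq_intros sum.cong simp del: sum.atMost_Suc)
  also have "(\<Sum>j\<le>Suc l. of_nat j * z ^ (j - 1) / of_nat (fact j)) = (\<Sum>j\<le>l. z ^ j / of_nat (fact j))"
    by (simp add: sum.atMost_Suc_shift del: sum.atMost_Suc of_nat_Suc)
  finally show ?thesis
    by (simp add: exp_rem_def[abs_def])
qed

lemma inversion_kernel_has_real_derivative:
  assumes t: "t > 0"
  shows "((\<lambda>x. inversion_kernel a (Suc l) t x) has_real_derivative inversion_kernel a l t x) (at x)"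
proof -
  let ?E = "\<lambda>z. exp_rem (Suc l) (\<i> * complex_of_real t * z) / it_pow (real (Suc l) + a) t"
  have "it_pow (real l + a) t \<noteq> 0"
    using t by (simp add: it_pow_def)
  moreover have "it_pow (real (Suc l) + a) t = \<i> * of_real t * it_pow (real l + a) t"
    using it_pow_Suc[OF t, of "real l + a"] by (simp add: add_ac)
  ultimately have "(?E has_field_derivative
      exp_rem l (\<i> * complex_of_real t * of_real x) / it_pow (real l + a) t) (at (of_real x))"
    using t by (auto intro!: derivative_eq_intros DERIV_chain2[OF exp_rem_has_field_derivative])
  from has_vector_derivative_real_field[OF this]
  have "((\<lambda>x. ?E (of_real x)) has_vector_derivative
      exp_rem l (\<i> * complex_of_real t * of_real x) / it_pow (real l + a) t) (at x)" .
  from bounded_linear.has_vector_derivative[OF bounded_linear_Re this]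
  show ?thesis
    by (simp add: inversion_kernel_def has_real_derivative_iff_has_vector_derivative mult.assoc)
qed

context
  fixes a :: real
  assumes a: "0 < a" "a < 1"
begin

lemma set_integrable_inversion_kernel:
  assumes "A \<in> sets borel" "A \<subseteq> {0<..}"
  shows "set_integrable lborel A (\<lambda>t. inversion_kernel a l t x)"
proof -
  have "set_integrable lborel {0<..} (\<lambda>t. inversion_kernel a l t x)"
  proof (rule set_integrable_bound)
    show "set_integrable lborel {0<..}
        (\<lambda>t. 2 * \<bar>x\<bar> ^ l * (min 1 ((\<bar>x\<bar> + 1) * t) * t powr (- a - 1)))"
      using a by (intro set_integrable_mult_right set_integrable_min_mult_powr) auto
    have "\<bar>inversion_kernel a l t x\<bar> \<le> 2 * \<bar>x\<bar> ^ l * (min 1 ((\<bar>x\<bar> + 1) * t) * t powr (- a - 1))"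
      if "t > 0" for t
    proof -
      have "min 1 (\<bar>x\<bar> * t) \<le> min 1 ((\<bar>x\<bar> + 1) * t)"
        using that by (intro min.mono mult_right_mono) auto
      then have "2 * \<bar>x\<bar> ^ l * (min 1 (\<bar>x\<bar> * t) * t powr (- a - 1))
          \<le> 2 * \<bar>x\<bar> ^ l * (min 1 ((\<bar>x\<bar> + 1) * t) * t powr (- a - 1))"
        by (intro mult_left_mono mult_right_mono) auto
      with abs_inversion_kernel_le[OF that, of a l x] show ?thesis
        by (rule order.trans)
    qed
    then show "AE t in lborel. t \<in> {0<..} \<longrightarrow> norm (inversion_kernel a l t x)
        \<le> norm (2 * \<bar>x\<bar> ^ l * (min 1 ((\<bar>x\<bar> + 1) * t) * t powr (- a - 1)))"
      by (intro AE_I2) (auto intro: order.trans[OF _ abs_ge_self])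
  qed (simp add: set_borel_measurable_def)
  then show ?thesis
    by (rule set_integrable_subset) (use assms in auto)
qed

lemma abs_set_integral_inversion_kernel_le:
  assumes A: "A \<in> sets borel" "A \<subseteq> {0<..}" and y: "y > 0"
    and min: "\<And>t. t \<in> A \<Longrightarrow> min 1 (\<bar>x\<bar> * t) \<le> m * min 1 (y * t)" and m: "m \<ge> 0"
  shows "\<bar>LINT t:A|lborel. inversion_kernel a l t x\<bar> \<le> 2 / (a * (1 - a)) * (\<bar>x\<bar> ^ l * m * y powr a)"
proof -
  let ?g = "\<lambda>t. min 1 (y * t) * t powr (- a - 1)"
  have g: "set_integrable lborel {0<..} ?g"
    using a y by (intro set_integrable_min_mult_powr)
  have "\<bar>LINT t:A|lborel. inversion_kernel a l t x\<bar> \<le> (LINT t:A|lborel. \<bar>inversion_kernel a l t x\<bar>)"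
    using set_integral_norm_bound[OF set_integrable_inversion_kernel[OF A]] by simp
  also have "\<dots> \<le> (\<integral>t. 2 * \<bar>x\<bar> ^ l * m * (indicator {0<..} t * ?g t) \<partial>lborel)"
    unfolding set_lebesgue_integral_def
  proof (rule integral_mono')
    show "integrable lborel (\<lambda>t. 2 * \<bar>x\<bar> ^ l * m * (indicator {0<..} t * ?g t))"
      using g by (simp add: set_integrable_def)
    fix t :: real
    show "0 \<le> 2 * \<bar>x\<bar> ^ l * m * (indicator {0<..} t * ?g t)"
      using y m by (simp add: indicator_def)
    show "indicator A t *\<^sub>R \<bar>inversion_kernel a l t x\<bar>
        \<le> 2 * \<bar>x\<bar> ^ l * m * (indicator {0<..} t * ?g t)"
    proof (cases "t \<in> A")
      case True
      then have t: "t > 0"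
        using A by auto
      have "\<bar>inversion_kernel a l t x\<bar> \<le> 2 * \<bar>x\<bar> ^ l * (min 1 (\<bar>x\<bar> * t) * t powr (- a - 1))"
        using t by (rule abs_inversion_kernel_le)
      also have "\<dots> \<le> 2 * \<bar>x\<bar> ^ l * (m * min 1 (y * t) * t powr (- a - 1))"
        by (intro mult_left_mono mult_right_mono min True) auto
      finally show ?thesis
        using True t by (simp add: mult_ac)
    next
      case False
      then show ?thesis
        using y m by (simp add: indicator_def)
    qed
  qed
  also have "\<dots> = 2 / (a * (1 - a)) * (\<bar>x\<bar> ^ l * m * y powr a)"
    using set_integral_min_mult_powr[OF y a] by (simp add: set_lebesgue_integral_def)
  finally show ?thesis .
qed

lemma abs_inversion_integral_le:
  assumes "v \<ge> 0"
  shows "\<bar>inversion_integral a l v x\<bar> \<le> 2 / (a * (1 - a)) * \<bar>x\<bar> powr (real l + a)"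
proof (cases "x = 0")
  case True
  then show ?thesis
    by simp
next
  case False
  have "\<bar>inversion_integral a l v x\<bar> \<le> 2 / (a * (1 - a)) * (\<bar>x\<bar> ^ l * 1 * \<bar>x\<bar> powr a)"
    unfolding inversion_integral_def using assms False
    by (intro abs_set_integral_inversion_kernel_le) auto
  also have "\<bar>x\<bar> ^ l * 1 * \<bar>x\<bar> powr a = \<bar>x\<bar> powr (real l + a)"
    using False by (simp add: powr_add powr_realpow)
  finally show ?thesis .
qed

lemma inversion_integral_tendsto:
  "((\<lambda>v. inversion_integral a l v x) \<longlongrightarrow> inversion_integral a l 0 x) (at_right 0)"
  unfolding inversion_integral_def set_lebesgue_integral_def
proof (rule integral_dominated_convergence_within)
  show "integrable lborel (\<lambda>t. \<bar>indicator {0<..} t *\<^sub>R inversion_kernel a l t x\<bar>)"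
    using set_integrable_inversion_kernel[of "{0<..}" l x]
    by (intro integrable_abs) (simp add: set_integrable_def)
  show "AE t in lborel. ((\<lambda>v. indicator {v<..} t *\<^sub>R inversion_kernel a l t x)
      \<longlongrightarrow> indicator {0<..} t *\<^sub>R inversion_kernel a l t x) (at_right 0)"
  proof (intro AE_I2 tendsto_eventually)
    fix t :: real
    show "\<forall>\<^sub>F v in at_right 0. indicator {v<..} t *\<^sub>R inversion_kernel a l t x
        = indicator {0<..} t *\<^sub>R inversion_kernel a l t x"
      by (auto simp: eventually_at_right_field indicator_def
          intro!: exI[of _ "if t > 0 then t else 1"])
  qed
  show "\<forall>\<^sub>F v in at_right 0. AE t in lborel. norm (indicator {v<..} t *\<^sub>R inversion_kernel a l t x)
      \<le> \<bar>indicator {0<..} t *\<^sub>R inversion_kernel a l t x\<bar>"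
    by (auto simp: eventually_at_right_field indicator_def intro!: exI[of _ 1])
qed auto

lemma inversion_integral_has_real_derivative:
  assumes v: "v \<ge> 0"
  shows "((\<lambda>x. inversion_integral a (Suc l) v x)
      has_real_derivative inversion_integral a l v x) (at x)"
  unfolding inversion_integral_def set_lebesgue_integral_def
proof (rule has_real_derivative_integral)
  let ?R = "\<bar>x\<bar> + 1"
  let ?w = "\<lambda>t. indicator {0<..} t * (2 * ?R ^ l * (min 1 (?R * t) * t powr (- a - 1)))"
  show "integrable lborel (\<lambda>t. indicator {v<..} t *\<^sub>R inversion_kernel a (Suc l) t y)" for y
    using set_integrable_inversion_kernel[of "{v<..}" "Suc l" y] v
    by (simp add: set_integrable_def subset_eq)
  show "((\<lambda>y. indicator {v<..} t *\<^sub>R inversion_kernel a (Suc l) t y) has_real_derivative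
      indicator {v<..} t *\<^sub>R inversion_kernel a l t y) (at y)" for y t
    using v inversion_kernel_has_real_derivative[of t a l y] by (cases "t > v") auto
  show "integrable lborel ?w"
    using set_integrable_mult_right[OF set_integrable_min_mult_powr[of ?R a], of "2 * ?R ^ l"] a
    by (simp add: set_integrable_def)
  show "\<bar>indicator {v<..} t *\<^sub>R inversion_kernel a l t y\<bar> \<le> ?w t" if "dist y x < 1" for y t
  proof (cases "t > v")
    case True
    then have t: "t > 0"
      using v by simp
    have y: "\<bar>y\<bar> \<le> ?R"
      using that by (simp add: dist_real_def)
    have "\<bar>inversion_kernel a l t y\<bar> \<le> 2 * \<bar>y\<bar> ^ l * (min 1 (\<bar>y\<bar> * t) * t powr (- a - 1))"
      using t by (rule abs_inversion_kernel_le)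
    also have "\<dots> \<le> 2 * ?R ^ l * (min 1 (?R * t) * t powr (- a - 1))"
      using t y by (intro mult_mono power_mono min.mono mult_nonneg_nonneg) auto
    finally show ?thesis
      using True t by simp
  next
    case False
    then show ?thesis
      by (simp add: indicator_def)
  qed
qed auto

end

section \<open>Value and sign of the inversion integral\<close>

definition tail_weight :: "real \<Rightarrow> nat \<Rightarrow> real \<Rightarrow> real" where
  "tail_weight a l x = (- 1) ^ l * inversion_integral a l 1 (- x)"

lemma tail_weight_measurable [measurable]: "tail_weight a l \<in> borel_measurable borel"
  unfolding tail_weight_def[abs_def] by measurable

lemma tail_weight_0 [simp]: "tail_weight a l 0 = 0"
  by (simp add: tail_weight_def)

lemma inversion_integral_minus_eq_tail_weight:
  assumes "v > 0"
  shows "inversion_integral a l v (- y)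
      = (- 1) ^ l * (v powr (- (real l + a)) * tail_weight a l (v * y))"
proof -
  have "v powr (- (real l + a)) = inverse (v powr (real l + a))"
    by (rule powr_minus)
  then have "v powr (- (real l + a)) * tail_weight a l (v * y)
      = (- 1) ^ l * inversion_integral a l v (- y)"
    using inversion_integral_scale[of v 1 a l "- y"] assms by (simp add: tail_weight_def)
  then show ?thesis
    by simp
qed

definition damped_power :: "nat \<Rightarrow> real \<Rightarrow> real" where
  "damped_power l y = y ^ l * min 1 y"

lemma damped_power_measurable [measurable]: "damped_power l \<in> borel_measurable borel"
  unfolding damped_power_def[abs_def] by measurable

lemma damped_power_nonneg: "y \<ge> 0 \<Longrightarrow> 0 \<le> damped_power l y"
  by (simp add: damped_power_def)

context
  fixes a :: real
  assumes a: "0 < a" "a < 1"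
begin

lemma inversion_integral_order_0_minus_one:
  "inversion_integral a 0 v (- 1)
    = (LINT t:{v<..}|lborel. t powr (- a - 1) * sin_drop (pi * a / 2) t)"
  by (simp add: inversion_integral_def inversion_kernel_order_0 sin_drop_minus)

lemma inversion_integral_order_0_eq_pos_part:
  "inversion_integral a 0 0 x = pi / Gamma (a + 1) * max 0 x powr a"
proof -
  define \<theta> where "\<theta> = pi * a / 2"
  have "0 < \<theta>" "\<theta> < pi / 2"
    using a by (auto simp: \<theta>_def)
  then have nz: "sin \<theta> \<noteq> 0" "cos \<theta> \<noteq> 0"
    using sin_gt_zero[of \<theta>] cos_gt_zero[of \<theta>] by auto
  have "inversion_integral a 0 0 1 = - (LINT t:{0<..}|lborel. t powr (- a - 1) * sin_drop (- \<theta>) t)"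
    by (simp add: inversion_integral_def inversion_kernel_order_0 \<theta>_def set_lebesgue_integral_def)
  then have one: "inversion_integral a 0 0 1 = pi / Gamma (a + 1)"
    using set_integral_powr_sin_drop[OF a, of "- \<theta>"] nz by (simp flip: \<theta>_def)
  have minus_one: "inversion_integral a 0 0 (- 1) = 0"
    using set_integral_powr_sin_drop[OF a, of \<theta>] nz
    by (simp add: inversion_integral_order_0_minus_one flip: \<theta>_def)
  consider "x = 0" | "x > 0" | "x < 0"
    by linarith
  then show ?thesis
  proof cases
    assume "x = 0"
    then show ?thesis
      by simp
  next
    assume "x > 0"
    then show ?thesis
      using inversion_integral_scale[of x 0 a 0 1] one by simp
  next
    assume "x < 0"
    then show ?thesis
      using inversion_integral_scale[of "- x" 0 a 0 "- 1"] minus_one by simp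
  qed
qed

lemma inversion_integral_eq_pos_part:
  "inversion_integral a l 0 x = pi / Gamma (real l + a + 1) * max 0 x powr (real l + a)"
proof (induction l arbitrary: x)
  case 0
  show ?case
    using inversion_integral_order_0_eq_pos_part by simp
next
  case (Suc l)
  let ?q = "real (Suc l) + a"
  let ?D = "\<lambda>x. inversion_integral a (Suc l) 0 x - pi / Gamma (?q + 1) * max 0 x powr ?q"
  have q: "?q > 0"
    using a by simp
  have "?q \<notin> \<int>\<^sub>\<le>\<^sub>0"
    using q by (auto elim!: nonpos_Ints_cases)
  then have Gamma: "Gamma (?q + 1) = ?q * Gamma ?q"
    by (rule Gamma_plus1)
  have "?D x = 0"
  proof (rule has_derivative_zero_unique_strong_convex[of UNIV "{0}" ?D 0])
    have "continuous_on UNIV (inversion_integral a (Suc l) 0)"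
      using inversion_integral_has_real_derivative[OF a order.refl]
      by (intro continuous_at_imp_continuous_on ballI DERIV_isCont)
    then show "continuous_on UNIV ?D"
      using q by (intro continuous_intros continuous_on_powr') auto
    show "?D 0 = 0"
      by simp
    fix y :: real
    assume y: "y \<in> UNIV - {0}"
    have "(?D has_real_derivative
        inversion_integral a l 0 y - pi / Gamma (?q + 1) * (?q * max 0 y powr (?q - 1))) (at y)"
      using y
      by (intro DERIV_diff DERIV_cmult inversion_integral_has_real_derivative[OF a order.refl]
          has_real_derivative_pos_part_powr) auto
    also have "pi / Gamma (?q + 1) * (?q * max 0 y powr (?q - 1)) = inversion_integral a l 0 y"
      unfolding Suc.IH Gamma using q by (simp add: add_ac)
    finally have "(?D has_real_derivative 0) (at y)"
      by simp
    then show "(?D has_derivative (\<lambda>h. 0)) (at y)"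
      by (simp add: has_field_derivative_def lambda_zero)
  qed auto
  then show ?case
    by simp
qed

lemma tail_weight_Suc_has_real_derivative:
  "(tail_weight a (Suc l) has_real_derivative tail_weight a l x) (at x)"
proof -
  have "((\<lambda>x. inversion_integral a (Suc l) 1 (- x))
      has_real_derivative - inversion_integral a l 1 (- x)) (at x)"
    using inversion_integral_has_real_derivative[OF a, of 1 l "- x"] by (simp add: DERIV_mirror)
  from DERIV_cmult[OF this, of "(- 1) ^ Suc l"] show ?thesis
    by (simp add: tail_weight_def[abs_def])
qed

lemma tail_weight_order_0_eq:
  assumes "x > 0"
  shows "tail_weight a 0 x
      = x powr a * (LINT t:{x<..}|lborel. t powr (- a - 1) * sin_drop (pi * a / 2) t)"
  using inversion_integral_scale[of x 1 a 0 "- 1"] assms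
  by (simp add: tail_weight_def inversion_integral_order_0_minus_one)

lemma tail_weight_nonneg: "x \<ge> 0 \<Longrightarrow> 0 \<le> tail_weight a l x"
proof (induction l arbitrary: x)
  case 0
  then show ?case
    using set_integral_powr_sin_drop_nonneg[OF a, of x]
    by (cases "x = 0") (auto simp: tail_weight_order_0_eq)
next
  case (Suc l)
  have "tail_weight a (Suc l) 0 \<le> tail_weight a (Suc l) x"
  proof (rule DERIV_nonneg_imp_nondecreasing[OF Suc.prems])
    show "\<exists>d. (tail_weight a (Suc l) has_real_derivative d) (at y) \<and> 0 \<le> d" if "0 \<le> y" for y
      using Suc.IH[OF that] tail_weight_Suc_has_real_derivative by blast
  qed
  then show ?case
    by simp
qed

lemma tail_weight_order_0_eventually_ge:
  "\<forall>\<^sub>F x in at_top. sin (pi * a / 2) / (2 * a) \<le> tail_weight a 0 x"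
proof -
  have sin: "sin (pi * a / 2) > 0"
    using a by (intro sin_gt_zero) auto
  show ?thesis
    using eventually_gt_at_top[of 0] eventually_ge_at_top[of "4 * a / sin (pi * a / 2)"]
  proof eventually_elim
    case (elim x)
    have "sin (pi * a / 2) / (2 * a) \<le> sin (pi * a / 2) / a - 2 / x"
      using elim a sin by (simp add: field_simps)
    also have "\<dots> = x powr a * (sin (pi * a / 2) / a * x powr (- a) - 2 * x powr (- a - 1))"
      using elim by (simp add: right_diff_distrib powr_minus powr_diff field_simps)
    also have "\<dots> \<le> tail_weight a 0 x"
      using elim a set_integral_powr_sin_drop_ge[of a x "pi * a / 2"]
      by (simp add: tail_weight_order_0_eq mult_left_mono)
    finally show ?case .
  qed
qed

lemma tail_weight_eventually_ge: "\<exists>\<delta>>0. \<forall>\<^sub>F x in at_top. \<delta> \<le> tail_weight a l x"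
proof (induction l)
  case 0
  have "sin (pi * a / 2) / (2 * a) > 0"
    using a by (intro divide_pos_pos sin_gt_zero) auto
  then show ?case
    using tail_weight_order_0_eventually_ge by blast
next
  case (Suc l)
  then obtain \<delta> where \<delta>: "\<delta> > 0" "\<forall>\<^sub>F x in at_top. \<delta> \<le> tail_weight a l x"
    by blast
  from \<delta>(2) eventually_ge_at_top[of 0] have "\<forall>\<^sub>F x in at_top. \<delta> \<le> tail_weight a l x \<and> 0 \<le> x"
    by (rule eventually_conj)
  then obtain c where ge: "\<And>x. x \<ge> c \<Longrightarrow> \<delta> \<le> tail_weight a l x" and "c \<ge> 0"
    by (auto simp: eventually_at_top_linorder)
  have "\<delta> \<le> tail_weight a (Suc l) x" if "x \<ge> c + 1" for x
  proof -
    have "tail_weight a (Suc l) c - \<delta> * c \<le> tail_weight a (Suc l) x - \<delta> * x"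
    proof (rule DERIV_nonneg_imp_nondecreasing[where f = "\<lambda>x. tail_weight a (Suc l) x - \<delta> * x"])
      fix y assume "c \<le> y"
      have "((\<lambda>x. tail_weight a (Suc l) x - \<delta> * x)
          has_real_derivative tail_weight a l y - \<delta>) (at y)"
        by (auto intro!: derivative_eq_intros tail_weight_Suc_has_real_derivative)
      then show "\<exists>d. ((\<lambda>x. tail_weight a (Suc l) x - \<delta> * x) has_real_derivative d) (at y) \<and> 0 \<le> d"
        using ge[OF \<open>c \<le> y\<close>] by (intro exI conjI) auto
    qed (use that in simp)
    moreover have "\<delta> * (c + 1) \<le> \<delta> * x"
      using that \<delta>(1) by (intro mult_left_mono) auto
    ultimately show ?thesis
      using tail_weight_nonneg[OF \<open>c \<ge> 0\<close>, of "Suc l"] by (simp add: algebra_simps)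
  qed
  then show ?case
    using \<delta>(1) by (auto simp: eventually_at_top_linorder)
qed

lemma tail_weight_le:
  assumes x: "x \<ge> 0"
  shows "tail_weight a l x \<le> 2 / (a * (1 - a)) * damped_power l x"
proof -
  have "\<bar>inversion_integral a l 1 (- x)\<bar> \<le> 2 / (a * (1 - a)) * (\<bar>- x\<bar> ^ l * min 1 x * 1 powr a)"
  proof (cases "x \<le> 1")
    case False
    then show ?thesis
      unfolding inversion_integral_def by (intro abs_set_integral_inversion_kernel_le[OF a]) auto
  next
    case True
    have "set_integrable lborel {0<..} (\<lambda>t. inversion_kernel a l t (- x))"
      by (rule set_integrable_inversion_kernel[OF a]) auto
    then have "inversion_integral a l 0 (- x)
        = (LINT t:{0<..1}|lborel. inversion_kernel a l t (- x)) + inversion_integral a l 1 (- x)"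
      using set_integral_greaterThan_split[of 0 _ 1] by (simp add: inversion_integral_def)
    then have "(LINT t:{0<..1}|lborel. inversion_kernel a l t (- x))
        = - inversion_integral a l 1 (- x)"
      using x inversion_integral_eq_pos_part[of l "- x"] by simp
    then have "\<bar>inversion_integral a l 1 (- x)\<bar>
        = \<bar>LINT t:{0<..1}|lborel. inversion_kernel a l t (- x)\<bar>"
      by simp
    also have "\<dots> \<le> 2 / (a * (1 - a)) * (\<bar>- x\<bar> ^ l * min 1 x * 1 powr a)"
      using True x by (intro abs_set_integral_inversion_kernel_le[OF a]) (auto simp: mult_le_one)
    finally show ?thesis .
  qed
  then have "\<bar>tail_weight a l x\<bar> \<le> 2 / (a * (1 - a)) * damped_power l x"
    using x by (simp add: tail_weight_def damped_power_def abs_mult power_abs)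
  then show ?thesis
    by (rule order.trans[OF abs_ge_self])
qed

end

section \<open>Tails and weighted moments\<close>

lemma damped_power_le_double:
  assumes "0 \<le> y" "y \<le> 2 * s"
  shows "damped_power l y \<le> 2 ^ Suc l * damped_power l s"
proof -
  have "y ^ l * min 1 y \<le> (2 * s) ^ l * (2 * min 1 s)"
    using assms by (intro mult_mono power_mono) auto
  then show ?thesis
    by (simp add: damped_power_def power_mult_distrib mult_ac)
qed

lemma damped_power_le_nn_integral:
  assumes "y \<ge> 0"
  shows "ennreal (damped_power l y)
    \<le> (\<integral>\<^sup>+s\<in>{..<y}. ennreal (indicator {0<..} s * (2 ^ (l + 2) * (damped_power l s / s))) \<partial>lborel)"
proof (cases "y = 0")
  case True
  then show ?thesis
    by (simp add: damped_power_def)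
next
  case False
  with assms have y: "y > 0"
    by simp
  have "ennreal (damped_power l y)
      = (\<integral>\<^sup>+s. ennreal (2 * damped_power l y / y) * indicator {y / 2..<y} s \<partial>lborel)"
    using y damped_power_nonneg[of y l] by (simp add: nn_integral_cmult ennreal_mult'[symmetric])
  also have "\<dots> \<le> (\<integral>\<^sup>+s\<in>{..<y}.
      ennreal (indicator {0<..} s * (2 ^ (l + 2) * (damped_power l s / s))) \<partial>lborel)"
  proof (intro nn_integral_mono)
    fix s :: real
    have "2 * damped_power l y / y \<le> 2 ^ (l + 2) * (damped_power l s / s)" if "s \<in> {y / 2..<y}"
    proof -
      have "2 * damped_power l y / y \<le> 2 * (2 ^ Suc l * damped_power l s) / s"
        using that y damped_power_le_double[of y s l] damped_power_nonneg[of s l]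
        by (intro frac_le mult_left_mono mult_nonneg_nonneg) auto
      then show ?thesis
        by simp
    qed
    then show "ennreal (2 * damped_power l y / y) * indicator {y / 2..<y} s
        \<le> ennreal (indicator {0<..} s * (2 ^ (l + 2) * (damped_power l s / s)))
          * indicator {..<y} s"
      using y by (cases "s \<in> {y / 2..<y}") (auto intro: ennreal_leI)
  qed
  finally show ?thesis .
qed

lemma
  fixes w K :: "real \<Rightarrow> real"
  assumes w: "set_integrable lborel {0<..} w"
    and [measurable]: "w \<in> borel_measurable borel" "K \<in> borel_measurable borel"
    and bound: "\<And>x. x > 0 \<Longrightarrow> \<bar>K x\<bar> \<le> B" and lim: "(K \<longlongrightarrow> 0) at_top"
  shows set_integrable_mult_rescaled: "v > 0 \<Longrightarrow> set_integrable lborel {0<..} (\<lambda>s. w s * K (s / v))"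
    and set_integral_mult_rescaled_tendsto_0:
      "((\<lambda>v. LINT s:{0<..}|lborel. w s * K (s / v)) \<longlongrightarrow> 0) (at_right 0)"
proof -
  have dominated: "norm (indicator {0<..} s *\<^sub>R (w s * K (s / v)))
      \<le> norm (B * (indicator {0<..} s * w s))"
    if "v > 0" for v s
    using that order.trans[OF bound[of "s / v"] abs_ge_self]
    by (cases "s > 0") (auto simp: abs_mult mult.commute[of _ "\<bar>w s\<bar>"] intro!: mult_left_mono)
  have B: "integrable lborel (\<lambda>s. norm (B * (indicator {0<..} s * w s)))"
    using w by (intro integrable_norm) (simp add: set_integrable_def)
  show "set_integrable lborel {0<..} (\<lambda>s. w s * K (s / v))" if "v > 0"
    unfolding set_integrable_def
    by (rule Bochner_Integration.integrable_bound[OF B]) (use dominated[OF that] in auto)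
  have "((\<lambda>v. LINT s:{0<..}|lborel. w s * K (s / v))
      \<longlongrightarrow> (\<integral>s. 0 \<partial>(lborel :: real measure))) (at_right 0)"
    unfolding set_lebesgue_integral_def
  proof (rule integral_dominated_convergence_within)
    show "AE s in lborel. ((\<lambda>v. indicator {0<..} s *\<^sub>R (w s * K (s / v))) \<longlongrightarrow> 0) (at_right 0)"
    proof (intro AE_I2)
      fix s :: real
      have "((\<lambda>v. K (s / v)) \<longlongrightarrow> 0) (at_right 0)" if "s > 0"
      proof (rule filterlim_compose[OF lim])
        show "filterlim (\<lambda>v. s / v) at_top (at_right 0)"
          using filterlim_tendsto_pos_mult_at_top
              [OF tendsto_const that filterlim_inverse_at_top_right]
          by (simp add: divide_inverse)
      qed
      then show "((\<lambda>v. indicator {0<..} s *\<^sub>R (w s * K (s / v))) \<longlongrightarrow> 0) (at_right 0)"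
        by (cases "s > 0") (auto intro: tendsto_mult_right_zero)
    qed
    show "\<forall>\<^sub>F v in at_right 0. AE s in lborel. norm (indicator {0<..} s *\<^sub>R (w s * K (s / v)))
        \<le> norm (B * (indicator {0<..} s * w s))"
      using dominated by (auto simp: eventually_at_right_field intro!: exI[of _ 1])
  qed (use B in auto)
  then show "((\<lambda>v. LINT s:{0<..}|lborel. w s * K (s / v)) \<longlongrightarrow> 0) (at_right 0)"
    by simp
qed

lemma smallo_powr_imp_tendsto_0:
  fixes q :: "real \<Rightarrow> real"
  assumes "q \<in> o[at_top](\<lambda>x. x powr (- p))"
  shows "((\<lambda>x. x powr p * q x) \<longlongrightarrow> 0) at_top"
  using smalloD_tendsto[OF assms] by (simp add: powr_minus divide_inverse mult.commute)

lemma smallo_powr_imp_bounded: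
  fixes q :: "real \<Rightarrow> real"
  assumes "p \<ge> 0" and q: "\<And>x. 0 \<le> q x" "\<And>x. q x \<le> C" and "q \<in> o[at_top](\<lambda>x. x powr (- p))"
  obtains B where "\<And>x. x > 0 \<Longrightarrow> \<bar>x powr p * q x\<bar> \<le> B"
proof -
  obtain c where c: "\<And>x. x \<ge> c \<Longrightarrow> x powr p * q x < 1"
    using order_tendstoD(2)[OF smallo_powr_imp_tendsto_0[OF assms(4)] zero_less_one]
    by (auto simp: eventually_at_top_linorder)
  have "\<bar>x powr p * q x\<bar> \<le> max 1 (\<bar>c\<bar> powr p * C)" if "x > 0" for x
  proof (cases "x \<ge> c")
    case True
    then show ?thesis
      using c[of x] q[of x] by (simp add: max_def)
  next
    case False
    then have "x powr p * q x \<le> \<bar>c\<bar> powr p * C"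
      using that q[of x] assms(1) by (intro mult_mono powr_mono2) auto
    then show ?thesis
      using q[of x] by (simp add: max_def)
  qed
  then show ?thesis
    by (rule that)
qed

text \<open>
  After the substitution \<open>s = v y\<close> the layer cake formula averages \<open>y\<^bsup>p\<^esup> P(Y > y)\<close>, which tends to zero,
  against an integrable density that does not depend on \<open>v\<close>.
\<close>

definition tail_average :: "real \<Rightarrow> nat \<Rightarrow> 'a measure \<Rightarrow> ('a \<Rightarrow> real) \<Rightarrow> real \<Rightarrow> real" where
  "tail_average a l M Y v = (LINT s:{0<..}|lborel. min 1 s * s powr (- a - 1) *
    ((s / v) powr (real l + a) * measure M {\<omega> \<in> space M. s / v < Y \<omega>}))"

lemma tail_average_nonneg: "0 \<le> tail_average a l M Y v"
  unfolding tail_average_def set_lebesgue_integral_def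
  by (intro Bochner_Integration.integral_nonneg) (simp add: indicator_def)

context finite_measure
begin

lemma borel_measurable_measure_tail [measurable]:
  assumes [measurable]: "Y \<in> borel_measurable M"
  shows "(\<lambda>x::real. measure M {\<omega> \<in> space M. x < Y \<omega>}) \<in> borel_measurable borel"
proof -
  have "mono (\<lambda>x::real. - measure M {\<omega> \<in> space M. x < Y \<omega>})"
    by (intro monoI le_imp_neg_le finite_measure_mono) auto
  then have "(\<lambda>x::real. - measure M {\<omega> \<in> space M. x < Y \<omega>}) \<in> borel_measurable borel"
    by (rule borel_measurable_mono)
  then show ?thesis
    by simp
qed

lemma nn_integral_damped_power_le:
  assumes [measurable]: "Y \<in> borel_measurable M" and Y: "\<And>\<omega>. 0 \<le> Y \<omega>" and v: "v > 0"
  shows "(\<integral>\<^sup>+\<omega>. ennreal (damped_power l (v * Y \<omega>)) \<partial>M)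
    \<le> (\<integral>\<^sup>+s. ennreal (indicator {0<..} s *
          (2 ^ (l + 2) * (damped_power l s / s) * measure M {\<omega> \<in> space M. s / v < Y \<omega>})) \<partial>lborel)"
proof -
  let ?\<psi> = "\<lambda>s. indicator {0<..} s * (2 ^ (l + 2) * (damped_power l s / s))"
  have weight: "ennreal (?\<psi> s) * emeasure M {\<omega> \<in> space M. s < v * Y \<omega>}
      = ennreal (?\<psi> s * measure M {\<omega> \<in> space M. s / v < Y \<omega>})" for s
    using v by (subst ennreal_mult)
      (auto simp: emeasure_eq_measure indicator_def damped_power_nonneg divide_less_eq mult.commute)
  have "(\<integral>\<^sup>+\<omega>. ennreal (damped_power l (v * Y \<omega>)) \<partial>M)
      \<le> (\<integral>\<^sup>+\<omega>. (\<integral>\<^sup>+s\<in>{..<v * Y \<omega>}. ennreal (?\<psi> s) \<partial>lborel) \<partial>M)"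
    using Y v by (intro nn_integral_mono damped_power_le_nn_integral) simp
  also have "\<dots> = (\<integral>\<^sup>+s. ennreal (?\<psi> s) * emeasure M {\<omega> \<in> space M. s < v * Y \<omega>} \<partial>lborel)"
    by (rule nn_integral_layer_cake) measurable
  also have "\<dots> = (\<integral>\<^sup>+s. ennreal (?\<psi> s * measure M {\<omega> \<in> space M. s / v < Y \<omega>}) \<partial>lborel)"
    by (simp only: weight)
  finally show ?thesis
    by (simp only: mult.assoc)
qed

lemma
  assumes a: "0 < a" "a < 1" and [measurable]: "Y \<in> borel_measurable M"
    and tail: "(\<lambda>x. measure M {\<omega> \<in> space M. x < Y \<omega>}) \<in> o[at_top](\<lambda>x. x powr (- (real l + a)))"
  shows set_integrable_tail_average: "v > 0 \<Longrightarrow> set_integrable lborel {0<..}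
      (\<lambda>s. min 1 s * s powr (- a - 1) *
        ((s / v) powr (real l + a) * measure M {\<omega> \<in> space M. s / v < Y \<omega>}))"
    and tail_average_tendsto_0: "(tail_average a l M Y \<longlongrightarrow> 0) (at_right 0)"
proof -
  let ?K = "\<lambda>x. x powr (real l + a) * measure M {\<omega> \<in> space M. x < Y \<omega>}"
  have density: "set_integrable lborel {0<..} (\<lambda>s. min 1 s * s powr (- a - 1))"
    using set_integrable_min_mult_powr[of 1 a] a by simp
  obtain B where B: "\<And>x. x > 0 \<Longrightarrow> \<bar>?K x\<bar> \<le> B"
    by (rule smallo_powr_imp_bounded[OF _ measure_nonneg bounded_measure tail]) (use a in auto)
  note lim = smallo_powr_imp_tendsto_0[OF tail]
  show "set_integrable lborel {0<..} (\<lambda>s. min 1 s * s powr (- a - 1) * ?K (s / v))" if "v > 0"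
    by (rule set_integrable_mult_rescaled[OF density _ _ B lim that]) measurable
  show "(tail_average a l M Y \<longlongrightarrow> 0) (at_right 0)"
    unfolding tail_average_def[abs_def]
    by (rule set_integral_mult_rescaled_tendsto_0[OF density _ _ B lim]) measurable
qed

lemma nn_integral_damped_power_le_tail_average:
  assumes a: "0 < a" "a < 1" and Y: "Y \<in> borel_measurable M" "\<And>\<omega>. 0 \<le> Y \<omega>" and v: "v > 0"
    and tail: "(\<lambda>x. measure M {\<omega> \<in> space M. x < Y \<omega>}) \<in> o[at_top](\<lambda>x. x powr (- (real l + a)))"
  shows "(\<integral>\<^sup>+\<omega>. ennreal (damped_power l (v * Y \<omega>)) \<partial>M)
    \<le> ennreal (2 ^ (l + 2) * v powr (real l + a) * tail_average a l M Y v)"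
proof -
  let ?c = "2 ^ (l + 2) * v powr (real l + a)"
  let ?P = "\<lambda>s. measure M {\<omega> \<in> space M. s / v < Y \<omega>}"
  let ?f = "\<lambda>s. indicator {0<..} s *
      (min 1 s * s powr (- a - 1) * ((s / v) powr (real l + a) * ?P s))"
  have rescale: "indicator {0<..} s * (2 ^ (l + 2) * (damped_power l s / s) * ?P s) = ?c * ?f s"
    for s
  proof (cases "s > 0")
    case True
    have "s powr (real l + a) = v powr (real l + a) * (s / v) powr (real l + a)"
      using True v by (simp add: powr_divide)
    moreover have "damped_power l s / s = s powr (real l + a) * (min 1 s * s powr (- a - 1))"
      using True
      by (simp add: damped_power_def powr_add powr_diff powr_minus powr_realpow divide_inverse)
    ultimately show ?thesis
      by simp
  qed simp
  have "(\<integral>\<^sup>+\<omega>. ennreal (damped_power l (v * Y \<omega>)) \<partial>M) \<le> (\<integral>\<^sup>+s. ennreal (?c * ?f s) \<partial>lborel)"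
    using nn_integral_damped_power_le[OF Y v, of l] by (simp only: rescale)
  also have "\<dots> = ennreal (\<integral>s. ?c * ?f s \<partial>lborel)"
    using set_integrable_tail_average[OF a Y(1) tail v]
    by (intro nn_integral_eq_integral) (auto simp: set_integrable_def indicator_def)
  finally show ?thesis
    by (simp add: tail_average_def set_lebesgue_integral_def)
qed

lemma
  fixes g :: "real \<Rightarrow> real"
  assumes a: "0 < a" "a < 1" and Y: "Y \<in> borel_measurable M" "\<And>\<omega>. 0 \<le> Y \<omega>"
    and g: "g \<in> borel_measurable borel" "\<And>y. 0 \<le> y \<Longrightarrow> 0 \<le> g y"
      "\<And>y. 0 \<le> y \<Longrightarrow> g y \<le> C * damped_power l y"
    and C: "C \<ge> 0"
    and tail: "(\<lambda>x. measure M {\<omega> \<in> space M. x < Y \<omega>}) \<in> o[at_top](\<lambda>x. x powr (- (real l + a)))"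
  shows integrable_weight_of_tail: "v > 0 \<Longrightarrow> integrable M (\<lambda>\<omega>. g (v * Y \<omega>))"
    and weighted_moment_tendsto_0_of_tail:
      "((\<lambda>v. v powr (- (real l + a)) * (\<integral>\<omega>. g (v * Y \<omega>) \<partial>M)) \<longlongrightarrow> 0) (at_right 0)"
proof -
  note [measurable] = Y(1) g(1)
  let ?p = "real l + a" and ?A = "tail_average a l M Y"
  have bound: "(\<integral>\<^sup>+\<omega>. ennreal (g (v * Y \<omega>)) \<partial>M) \<le> ennreal (C * (2 ^ (l + 2) * v powr ?p * ?A v))"
    if v: "v > 0" for v
  proof -
    have "(\<integral>\<^sup>+\<omega>. ennreal (g (v * Y \<omega>)) \<partial>M)
        \<le> (\<integral>\<^sup>+\<omega>. ennreal C * ennreal (damped_power l (v * Y \<omega>)) \<partial>M)"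
      using g(3) Y v C by (intro nn_integral_mono) (simp add: ennreal_mult'[symmetric] ennreal_leI)
    also have "\<dots> = ennreal C * (\<integral>\<^sup>+\<omega>. ennreal (damped_power l (v * Y \<omega>)) \<partial>M)"
      by (simp add: nn_integral_cmult)
    also have "\<dots> \<le> ennreal C * ennreal (2 ^ (l + 2) * v powr ?p * ?A v)"
      using nn_integral_damped_power_le_tail_average[OF a Y v tail] by (rule mult_left_mono) simp
    finally show ?thesis
      using C by (simp add: ennreal_mult'[symmetric])
  qed
  show "integrable M (\<lambda>\<omega>. g (v * Y \<omega>))" if "v > 0"
    using le_less_trans[OF bound[OF that]] g(2) Y that by (intro integrableI_nonneg) auto
  show "((\<lambda>v. v powr (- ?p) * (\<integral>\<omega>. g (v * Y \<omega>) \<partial>M)) \<longlongrightarrow> 0) (at_right 0)"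
  proof (rule Lim_null_comparison)
    show "((\<lambda>v. C * 2 ^ (l + 2) * ?A v) \<longlongrightarrow> 0) (at_right 0)"
      by (intro tendsto_mult_right_zero tail_average_tendsto_0[OF a Y(1) tail])
    show "\<forall>\<^sub>F v in at_right 0. norm (v powr (- ?p) * (\<integral>\<omega>. g (v * Y \<omega>) \<partial>M)) \<le> C * 2 ^ (l + 2) * ?A v"
      using eventually_at_right_less[of "0::real"]
    proof eventually_elim
      case (elim v)
      have "0 \<le> (\<integral>\<omega>. g (v * Y \<omega>) \<partial>M)"
        using g(2) Y(2) elim by (intro Bochner_Integration.integral_nonneg) simp
      moreover have "(\<integral>\<omega>. g (v * Y \<omega>) \<partial>M) \<le> C * (2 ^ (l + 2) * v powr ?p * ?A v)"
        using bound[OF elim] C tail_average_nonneg[of a l M Y v]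
        by (intro integral_real_bounded) auto
      ultimately have "norm (v powr (- ?p) * (\<integral>\<omega>. g (v * Y \<omega>) \<partial>M))
          \<le> v powr (- ?p) * (C * (2 ^ (l + 2) * v powr ?p * ?A v))"
        by (simp add: abs_mult mult_left_mono)
      also have "\<dots> = C * 2 ^ (l + 2) * ?A v"
        using elim by (simp only: powr_minus) simp
      finally show ?case .
    qed
  qed
qed

lemma measure_tail_le_weighted_moment:
  fixes g :: "real \<Rightarrow> real"
  assumes [measurable]: "Y \<in> borel_measurable M" and Y: "\<And>\<omega>. 0 \<le> Y \<omega>"
    and g: "\<And>y. 0 \<le> y \<Longrightarrow> 0 \<le> g y" "\<And>y. c \<le> y \<Longrightarrow> \<delta> \<le> g y"
    and v: "v > 0" and int: "integrable M (\<lambda>\<omega>. g (v * Y \<omega>))"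
  shows "\<delta> * measure M {\<omega> \<in> space M. c / v < Y \<omega>} \<le> (\<integral>\<omega>. g (v * Y \<omega>) \<partial>M)"
proof -
  let ?tail = "{\<omega> \<in> space M. c / v < Y \<omega>}"
  have "\<delta> * measure M ?tail = (\<integral>\<omega>. \<delta> * indicator ?tail \<omega> \<partial>M)"
    by simp
  also have "\<dots> \<le> (\<integral>\<omega>. g (v * Y \<omega>) \<partial>M)"
  proof (rule integral_mono)
    show "\<delta> * indicator ?tail \<omega> \<le> g (v * Y \<omega>)" if "\<omega> \<in> space M" for \<omega>
    proof (cases "c / v < Y \<omega>")
      case True
      then have "c \<le> v * Y \<omega>"
        using v by (simp add: field_simps)
      then show ?thesis
        using g(2) True that by simp
    qed (use g(1) v Y in simp)
  qed (use int in \<open>auto simp: emeasure_eq_measure\<close>)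
  finally show ?thesis .
qed

lemma tail_smallo_of_weighted_moment:
  fixes g :: "real \<Rightarrow> real"
  assumes Y: "Y \<in> borel_measurable M" "\<And>\<omega>. 0 \<le> Y \<omega>"
    and g: "\<And>y. 0 \<le> y \<Longrightarrow> 0 \<le> g y" and \<delta>: "\<delta> > 0" "\<forall>\<^sub>F y in at_top. \<delta> \<le> g y"
    and int: "\<And>v. v > 0 \<Longrightarrow> integrable M (\<lambda>\<omega>. g (v * Y \<omega>))"
    and lim: "((\<lambda>v. v powr (- p) * (\<integral>\<omega>. g (v * Y \<omega>) \<partial>M)) \<longlongrightarrow> 0) (at_right 0)"
  shows "(\<lambda>x. measure M {\<omega> \<in> space M. x < Y \<omega>}) \<in> o[at_top](\<lambda>x. x powr (- p))"
proof -
  let ?W = "\<lambda>v. v powr (- p) * (\<integral>\<omega>. g (v * Y \<omega>) \<partial>M)"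
  obtain c where c: "c > 0" and ge: "\<And>y. y \<ge> c \<Longrightarrow> \<delta> \<le> g y"
  proof -
    from eventually_conj[OF \<delta>(2) eventually_gt_at_top[of 0]]
    obtain c where "\<And>y. y \<ge> c \<Longrightarrow> \<delta> \<le> g y \<and> 0 < y"
      by (auto simp: eventually_at_top_linorder)
    then show ?thesis
      by (intro that[of c]) auto
  qed
  have "filterlim (\<lambda>x. c / x) (at_right 0) at_top"
    using filterlim_times_pos[OF filterlim_inverse_at_right_top c, of 0]
    by (simp add: divide_inverse)
  then have W: "((\<lambda>x. c powr p / \<delta> * ?W (c / x)) \<longlongrightarrow> 0) at_top"
    by (intro tendsto_mult_right_zero filterlim_compose[OF lim])
  have "((\<lambda>x. measure M {\<omega> \<in> space M. x < Y \<omega>} / x powr (- p)) \<longlongrightarrow> 0) at_top"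
  proof (rule tendsto_sandwich[OF _ _ tendsto_const W])
    show "\<forall>\<^sub>F x in at_top. measure M {\<omega> \<in> space M. x < Y \<omega>} / x powr (- p)
        \<le> c powr p / \<delta> * ?W (c / x)"
      using eventually_gt_at_top[of 0]
    proof eventually_elim
      case (elim x)
      have v: "c / x > 0" "c / (c / x) = x"
        using elim c by auto
      have "\<delta> * measure M {\<omega> \<in> space M. c / (c / x) < Y \<omega>} \<le> (\<integral>\<omega>. g (c / x * Y \<omega>) \<partial>M)"
        by (rule measure_tail_le_weighted_moment[OF Y g ge v(1) int[OF v(1)]])
      then have "measure M {\<omega> \<in> space M. x < Y \<omega>} \<le> (\<integral>\<omega>. g (c / x * Y \<omega>) \<partial>M) / \<delta>"
        unfolding v(2) using \<delta>(1) by (simp add: le_divide_eq mult.commute)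
      then have "x powr p * measure M {\<omega> \<in> space M. x < Y \<omega>}
          \<le> x powr p * ((\<integral>\<omega>. g (c / x * Y \<omega>) \<partial>M) / \<delta>)"
        by (rule mult_left_mono) simp
      moreover have "(c / x) powr (- p) = x powr p / c powr p"
        using elim c by (simp add: powr_divide powr_minus_divide)
      ultimately show ?case
        using c by (simp add: powr_minus_divide mult.commute)
    qed
  qed simp
  then show ?thesis
    using eventually_gt_at_top[of "0::real"] by (intro smalloI_tendsto) (auto elim: eventually_mono)
qed

end

section \<open>The inversion formula\<close>

definition inversion_integrand :: "real \<Rightarrow> nat \<Rightarrow> 'a measure \<Rightarrow> ('a \<Rightarrow> real) \<Rightarrow> real \<Rightarrow> real" where
  "inversion_integrand a l M X t =
    Re ((\<integral>\<omega>. exp_rem l (\<i> * complex_of_real (t * X \<omega>)) \<partial>M) / it_pow (real l + a) t)"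

lemma inversion_integrand_eq_integral_kernel:
  assumes [measurable]: "X \<in> borel_measurable M" and X: "integrable M (\<lambda>\<omega>. \<bar>X \<omega>\<bar> ^ l)"
  shows "inversion_integrand a l M X t = (\<integral>\<omega>. inversion_kernel a l t (X \<omega>) \<partial>M)"
proof -
  have "integrable M (\<lambda>\<omega>. exp_rem l (\<i> * complex_of_real (t * X \<omega>)))"
  proof (rule Bochner_Integration.integrable_bound)
    show "integrable M (\<lambda>\<omega>. 2 * \<bar>t\<bar> ^ l * \<bar>X \<omega>\<bar> ^ l)"
      using X by simp
    have "norm (exp_rem l (\<i> * complex_of_real (t * X \<omega>))) \<le> 2 * \<bar>t * X \<omega>\<bar> ^ l * 1" for \<omega>
      by (rule order.trans[OF norm_exp_rem_le mult_left_mono]) auto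
    then show "AE \<omega> in M. norm (exp_rem l (\<i> * complex_of_real (t * X \<omega>)))
        \<le> norm (2 * \<bar>t\<bar> ^ l * \<bar>X \<omega>\<bar> ^ l)"
      by (intro AE_I2) (simp add: abs_mult power_mult_distrib mult_ac)
  qed measurable
  then have "integrable M (\<lambda>\<omega>. exp_rem l (\<i> * complex_of_real (t * X \<omega>)) / it_pow (real l + a) t)"
    by (rule integrable_divide)
  from integral_Re[OF this] show ?thesis
    by (simp add: inversion_integrand_def inversion_kernel_def)
qed

lemma (in sigma_finite_measure)
  assumes a: "0 < a" and [measurable]: "X \<in> borel_measurable M"
    and X: "integrable M (\<lambda>\<omega>. \<bar>X \<omega>\<bar> ^ l)" and v: "v > 0"
  shows integrable_inversion_integral: "integrable M (\<lambda>\<omega>. inversion_integral a l v (X \<omega>))"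
    and set_integrable_inversion_integrand:
      "set_integrable lborel {v..} (inversion_integrand a l M X)"
    and set_integral_inversion_integrand:
      "(LINT t:{v..}|lborel. inversion_integrand a l M X t)
       = (\<integral>\<omega>. inversion_integral a l v (X \<omega>) \<partial>M)"
proof -
  interpret pair_sigma_finite M lborel ..
  let ?F = "\<lambda>\<omega> t. indicator {v<..} t * inversion_kernel a l t (X \<omega>)"
  have "integrable lborel (\<lambda>t. indicator {v<..} t * t powr (- a - 1))"
    using set_integrable_powr_greaterThan[OF v, of "- a - 1"] a by (simp add: set_integrable_def)
  from integrable_mult_pair[OF integrable_mult_right[OF X, of 2] this]
  have int: "integrable (M \<Otimes>\<^sub>M lborel) (case_prod ?F)"
  proof (rule Bochner_Integration.integrable_bound)
    have "\<bar>inversion_kernel a l t x\<bar> \<le> 2 * \<bar>x\<bar> ^ l * t powr (- a - 1)" if "t > 0" for t x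
    proof -
      have "2 * \<bar>x\<bar> ^ l * (min 1 (\<bar>x\<bar> * t) * t powr (- a - 1))
          \<le> 2 * \<bar>x\<bar> ^ l * (1 * t powr (- a - 1))"
        by (intro mult_left_mono mult_right_mono) auto
      with abs_inversion_kernel_le[OF that, of a l x] show ?thesis
        by simp
    qed
    then show "AE z in M \<Otimes>\<^sub>M lborel. norm (case_prod ?F z)
        \<le> norm (case z of (\<omega>, t) \<Rightarrow> 2 * \<bar>X \<omega>\<bar> ^ l * (indicator {v<..} t * t powr (- a - 1)))"
      using v by (intro AE_I2) (auto simp: indicator_def abs_mult)
  qed measurable
  have inner_t: "(\<integral>t. ?F \<omega> t \<partial>lborel) = inversion_integral a l v (X \<omega>)" for \<omega>
    by (simp add: inversion_integral_def set_lebesgue_integral_def)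
  have inner_\<omega>: "(\<integral>\<omega>. ?F \<omega> t \<partial>M) = indicator {v<..} t *\<^sub>R inversion_integrand a l M X t" for t
    by (simp add: inversion_integrand_eq_integral_kernel[OF _ X])
  show "integrable M (\<lambda>\<omega>. inversion_integral a l v (X \<omega>))"
    using integrable_fst'[OF int] by (simp only: prod.case inner_t)
  show "set_integrable lborel {v..} (inversion_integrand a l M X)"
    unfolding set_integrable_lborel_atLeast unfolding set_integrable_def
    using integrable_snd[OF int] by (simp only: inner_\<omega>)
  show "(LINT t:{v..}|lborel. inversion_integrand a l M X t)
      = (\<integral>\<omega>. inversion_integral a l v (X \<omega>) \<partial>M)"
    unfolding set_integral_lborel_atLeast unfolding set_lebesgue_integral_def
    using Fubini_integral[OF int] by (simp only: inner_t inner_\<omega>)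
qed

context
  fixes a :: real
  assumes a: "0 < a" "a < 1"
begin

lemma integrable_inversion_integral_powr:
  assumes [measurable]: "X \<in> borel_measurable M" and X: "integrable M (\<lambda>\<omega>. \<bar>X \<omega>\<bar> powr (real l + a))"
    and v: "v \<ge> 0"
  shows "integrable M (\<lambda>\<omega>. inversion_integral a l v (X \<omega>))"
proof (rule Bochner_Integration.integrable_bound[OF integrable_mult_right[OF X]])
  show "AE \<omega> in M. norm (inversion_integral a l v (X \<omega>))
      \<le> norm (2 / (a * (1 - a)) * \<bar>X \<omega>\<bar> powr (real l + a))"
    unfolding real_norm_def
    by (intro AE_I2 order.trans[OF abs_inversion_integral_le[OF a v] abs_ge_self])
qed measurable

lemma integral_inversion_integral_tendsto:
  assumes [measurable]: "X \<in> borel_measurable M" and X: "integrable M (\<lambda>\<omega>. \<bar>X \<omega>\<bar> powr (real l + a))"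
  shows "((\<lambda>v. Gamma (real l + a + 1) / pi * (\<integral>\<omega>. inversion_integral a l v (X \<omega>) \<partial>M))
    \<longlongrightarrow> (\<integral>\<omega>. max 0 (X \<omega>) powr (real l + a) \<partial>M)) (at_right 0)"
proof -
  have "((\<lambda>v. \<integral>\<omega>. inversion_integral a l v (X \<omega>) \<partial>M)
      \<longlongrightarrow> (\<integral>\<omega>. inversion_integral a l 0 (X \<omega>) \<partial>M)) (at_right 0)"
  proof (rule integral_dominated_convergence_within)
    show "integrable M (\<lambda>\<omega>. 2 / (a * (1 - a)) * \<bar>X \<omega>\<bar> powr (real l + a))"
      using X by (rule integrable_mult_right)
    show "AE \<omega> in M. ((\<lambda>v. inversion_integral a l v (X \<omega>))
        \<longlongrightarrow> inversion_integral a l 0 (X \<omega>)) (at_right 0)"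
      by (intro AE_I2 inversion_integral_tendsto[OF a])
    show "\<forall>\<^sub>F v in at_right 0. AE \<omega> in M.
        norm (inversion_integral a l v (X \<omega>)) \<le> 2 / (a * (1 - a)) * \<bar>X \<omega>\<bar> powr (real l + a)"
      using eventually_at_right_less[of "0::real"]
      by eventually_elim
         (simp only: real_norm_def abs_inversion_integral_le[OF a] less_imp_le AE_I2)
  qed measurable
  also have "(\<integral>\<omega>. inversion_integral a l 0 (X \<omega>) \<partial>M)
      = pi / Gamma (real l + a + 1) * (\<integral>\<omega>. max 0 (X \<omega>) powr (real l + a) \<partial>M)"
    by (simp add: inversion_integral_eq_pos_part[OF a])
  finally have lim: "((\<lambda>v. \<integral>\<omega>. inversion_integral a l v (X \<omega>) \<partial>M)
      \<longlongrightarrow> pi / Gamma (real l + a + 1) * (\<integral>\<omega>. max 0 (X \<omega>) powr (real l + a) \<partial>M)) (at_right 0)" .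
  have "Gamma (real l + a + 1) > 0"
    using a by (intro Gamma_real_pos) auto
  then show ?thesis
    using tendsto_mult_left[OF lim, of "Gamma (real l + a + 1) / pi"] by simp
qed

lemma abs_power_le_pos_part_neg_part:
  "\<bar>x\<bar> ^ l \<le> 1 + max 0 x powr (real l + a) + damped_power l (max 0 (- x))"
proof (cases "\<bar>x\<bar> \<le> 1")
  case True
  then have "\<bar>x\<bar> ^ l \<le> 1"
    by (intro power_le_one) auto
  moreover have "0 \<le> damped_power l (max 0 (- x))"
    by (simp add: damped_power_nonneg)
  ultimately show ?thesis
    using powr_ge_zero[of "max 0 x" "real l + a"] by linarith
next
  case False
  have "x ^ l \<le> x powr (real l + a)" if "x > 1"
    using that a powr_mono[of "real l" "real l + a" x] by (simp add: powr_realpow)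
  then show ?thesis
    using False by (auto simp: damped_power_def add_increasing2 abs_real_def max_def)
qed

end

lemma
  assumes a: "0 < a" "a < 1" and [measurable]: "X \<in> borel_measurable M"
    and pos: "integrable M (\<lambda>\<omega>. max 0 (X \<omega>) powr (real l + a))"
    and v: "v > 0" and int: "integrable M (\<lambda>\<omega>. inversion_integral a l v (X \<omega>))"
  shows integrable_tail_weight: "integrable M (\<lambda>\<omega>. tail_weight a l (v * max 0 (- X \<omega>)))"
    and integral_inversion_integral_split:
      "(\<integral>\<omega>. inversion_integral a l v (X \<omega>) \<partial>M) = (\<integral>\<omega>. inversion_integral a l v (max 0 (X \<omega>)) \<partial>M)
       + (- 1) ^ l * (v powr (- (real l + a)) * (\<integral>\<omega>. tail_weight a l (v * max 0 (- X \<omega>)) \<partial>M))"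
proof -
  have split: "inversion_integral a l v (X \<omega>)
      = inversion_integral a l v (max 0 (X \<omega>)) + inversion_integral a l v (- max 0 (- X \<omega>))" for \<omega>
    by (cases "X \<omega> \<ge> 0") auto
  have pos_int: "integrable M (\<lambda>\<omega>. inversion_integral a l v (max 0 (X \<omega>)))"
    using pos v by (intro integrable_inversion_integral_powr[OF a]) auto
  have "integrable M (\<lambda>\<omega>. inversion_integral a l v (X \<omega>) - inversion_integral a l v (max 0 (X \<omega>)))"
    using int pos_int by (rule Bochner_Integration.integrable_diff)
  then have neg_int: "integrable M (\<lambda>\<omega>. inversion_integral a l v (- max 0 (- X \<omega>)))"
    by (simp add: split)
  then show "integrable M (\<lambda>\<omega>. tail_weight a l (v * max 0 (- X \<omega>)))"
    using v by (simp add: inversion_integral_minus_eq_tail_weight)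
  show "(\<integral>\<omega>. inversion_integral a l v (X \<omega>) \<partial>M) = (\<integral>\<omega>. inversion_integral a l v (max 0 (X \<omega>)) \<partial>M)
       + (- 1) ^ l * (v powr (- (real l + a)) * (\<integral>\<omega>. tail_weight a l (v * max 0 (- X \<omega>)) \<partial>M))"
    unfolding split Bochner_Integration.integral_add[OF pos_int neg_int]
    using v by (simp add: inversion_integral_minus_eq_tail_weight)
qed

lemma tendsto_add_iff_tendsto_0:
  fixes f g :: "'a \<Rightarrow> 'b::real_normed_vector"
  assumes "(f \<longlongrightarrow> c) F"
  shows "((\<lambda>x. f x + g x) \<longlongrightarrow> c) F \<longleftrightarrow> (g \<longlongrightarrow> 0) F"
  using tendsto_add[OF assms, of g 0] tendsto_diff[OF _ assms, of "\<lambda>x. f x + g x" c] by auto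

lemma (in sigma_finite_measure) inversion_limit_iff_weighted_moment_limit:
  assumes a: "0 < a" "a < 1" and X: "X \<in> borel_measurable M"
    and pos: "integrable M (\<lambda>\<omega>. max 0 (X \<omega>) powr (real l + a))"
    and int: "integrable M (\<lambda>\<omega>. \<bar>X \<omega>\<bar> ^ l)"
  shows "((\<lambda>v. Gamma (real l + a + 1) / pi * (LINT t:{v..}|lborel. inversion_integrand a l M X t))
      \<longlongrightarrow> (\<integral>\<omega>. max 0 (X \<omega>) powr (real l + a) \<partial>M)) (at_right 0)
    \<longleftrightarrow> ((\<lambda>v. v powr (- (real l + a)) * (\<integral>\<omega>. tail_weight a l (v * max 0 (- X \<omega>)) \<partial>M))
      \<longlongrightarrow> 0) (at_right 0)"
    (is "(?J \<longlongrightarrow> ?E) _ \<longleftrightarrow> (?W \<longlongrightarrow> 0) _")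
proof -
  let ?c = "Gamma (real l + a + 1) / pi"
  let ?P = "\<lambda>v. ?c * (\<integral>\<omega>. inversion_integral a l v (max 0 (X \<omega>)) \<partial>M)"
  have P: "(?P \<longlongrightarrow> ?E) (at_right 0)"
    using integral_inversion_integral_tendsto[OF a, of "\<lambda>\<omega>. max 0 (X \<omega>)" M l] X pos by simp
  have "Gamma (real l + a + 1) > 0"
    using a by (intro Gamma_real_pos) auto
  then have c: "?c * (- 1) ^ l \<noteq> 0"
    by simp
  have "?J v = ?P v + ?c * (- 1) ^ l * ?W v" if "v > 0" for v
    using integral_inversion_integral_split
        [OF a X pos that integrable_inversion_integral[OF a(1) X int that]]
    by (simp add: set_integral_inversion_integrand[OF a(1) X int that] distrib_left)
  then have "\<forall>\<^sub>F v in at_right 0. ?J v = ?P v + ?c * (- 1) ^ l * ?W v"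
    using eventually_at_right_less[of "0::real"] by (auto elim: eventually_mono)
  then have "(?J \<longlongrightarrow> ?E) (at_right 0) \<longleftrightarrow> ((\<lambda>v. ?P v + ?c * (- 1) ^ l * ?W v) \<longlongrightarrow> ?E) (at_right 0)"
    by (rule tendsto_cong)
  also have "((\<lambda>v. ?P v + ?c * (- 1) ^ l * ?W v) \<longlongrightarrow> ?E) (at_right 0)
      \<longleftrightarrow> ((\<lambda>v. ?c * (- 1) ^ l * ?W v) \<longlongrightarrow> 0) (at_right 0)"
    by (rule tendsto_add_iff_tendsto_0[OF P])
  also have "\<dots> \<longleftrightarrow> (?W \<longlongrightarrow> 0) (at_right 0)"
    using tendsto_mult_left_iff[OF c, of ?W 0] by simp
  finally show ?thesis .
qed

context finite_measure
begin

lemma tail_smallo_iff_tail_weight_moment: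
  assumes a: "0 < a" "a < 1" and Y: "Y \<in> borel_measurable M" "\<And>\<omega>. 0 \<le> Y \<omega>"
  shows "(\<lambda>x. measure M {\<omega> \<in> space M. x < Y \<omega>}) \<in> o[at_top](\<lambda>x. x powr (- (real l + a)))
    \<longleftrightarrow> (\<forall>v>0. integrable M (\<lambda>\<omega>. tail_weight a l (v * Y \<omega>)))
      \<and> ((\<lambda>v. v powr (- (real l + a)) * (\<integral>\<omega>. tail_weight a l (v * Y \<omega>) \<partial>M)) \<longlongrightarrow> 0) (at_right 0)"
    (is "?tail \<longleftrightarrow> ?moment")
proof
  assume ?tail
  note weight = tail_weight_measurable tail_weight_nonneg[OF a] tail_weight_le[OF a] _ \<open>?tail\<close>
  show ?moment
    using a integrable_weight_of_tail[OF a Y weight]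
      weighted_moment_tendsto_0_of_tail[OF a Y weight]
    by simp
next
  assume moment: ?moment
  obtain \<delta> where "\<delta> > 0" "\<forall>\<^sub>F y in at_top. \<delta> \<le> tail_weight a l y"
    using tail_weight_eventually_ge[OF a] by blast
  with moment show ?tail
    by (intro tail_smallo_of_weighted_moment[OF Y tail_weight_nonneg[OF a]]) auto
qed

lemma integrable_abs_power_of_tail:
  assumes a: "0 < a" "a < 1" and [measurable]: "X \<in> borel_measurable M"
    and pos: "integrable M (\<lambda>\<omega>. max 0 (X \<omega>) powr (real l + a))"
    and tail: "(\<lambda>x. measure M {\<omega> \<in> space M. x < max 0 (- X \<omega>)})
        \<in> o[at_top](\<lambda>x. x powr (- (real l + a)))"
  shows "integrable M (\<lambda>\<omega>. \<bar>X \<omega>\<bar> ^ l)"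
proof (rule Bochner_Integration.integrable_bound)
  have "integrable M (\<lambda>\<omega>. damped_power l (1 * max 0 (- X \<omega>)))"
    by (rule integrable_weight_of_tail[OF a, where C = 1])
       (use tail in \<open>auto simp: damped_power_nonneg\<close>)
  then show "integrable M (\<lambda>\<omega>. 1 + max 0 (X \<omega>) powr (real l + a) + damped_power l (max 0 (- X \<omega>)))"
    using pos by simp
  show "AE \<omega> in M. norm (\<bar>X \<omega>\<bar> ^ l)
      \<le> norm (1 + max 0 (X \<omega>) powr (real l + a) + damped_power l (max 0 (- X \<omega>)))"
    using abs_power_le_pos_part_neg_part[OF a]
    by (intro AE_I2) (auto intro: order.trans[OF _ abs_ge_self])
qed measurable

end

lemma nonnatural_real_decomp:
  fixes p :: real
  assumes "p > 0" "p \<notin> \<nat>"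
  obtains a where "0 < a" "a < 1" "p = real (nat \<lceil>p - 1\<rceil>) + a"
proof
  have "\<lceil>p - 1\<rceil> \<ge> 0"
    using assms by linarith
  then have l: "real (nat \<lceil>p - 1\<rceil>) = of_int \<lceil>p - 1\<rceil>"
    by simp
  show "0 < p - real (nat \<lceil>p - 1\<rceil>)"
    unfolding l by linarith
  have "p \<noteq> real (Suc (nat \<lceil>p - 1\<rceil>))"
    using assms(2) by (metis of_nat_in_Nats)
  moreover have "p \<le> real (nat \<lceil>p - 1\<rceil>) + 1"
    unfolding l by linarith
  ultimately show "p - real (nat \<lceil>p - 1\<rceil>) < 1"
    by simp
qed simp

theorem theorem2p5:
  fixes M :: "'a measure" and X :: "'a \<Rightarrow> real" and p :: real
  assumes "prob_space M"
    and "X \<in> borel_measurable M"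
    and "p > 0" and "p \<notin> \<nat>"
    and "integrable M (\<lambda>\<omega>. (max 0 (X \<omega>)) powr p)"
  shows "(integrable M (\<lambda>\<omega>. \<bar>X \<omega>\<bar> ^ nat \<lceil>p - 1\<rceil>) \<and>
          (\<forall>v>0. set_integrable lborel {v..}
             (\<lambda>t. Re ((\<integral>\<omega>. exp_rem (nat \<lceil>p - 1\<rceil>) (\<i> * complex_of_real (t * X \<omega>)) \<partial>M)
                     / it_pow p t))) \<and>
          ((\<lambda>v. Gamma (p + 1) / pi *
              (LINT t:{v..}|lborel.
                 Re ((\<integral>\<omega>. exp_rem (nat \<lceil>p - 1\<rceil>) (\<i> * complex_of_real (t * X \<omega>)) \<partial>M)
                     / it_pow p t)))
            \<longlongrightarrow> (\<integral>\<omega>. (max 0 (X \<omega>)) powr p \<partial>M)) (at_right 0))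
     \<longleftrightarrow>
         (\<lambda>x. measure M {\<omega> \<in> space M. max 0 (- X \<omega>) > x}) \<in> o[at_top](\<lambda>x. x powr (- p))"
proof -
  interpret prob_space M by fact
  define l where "l = nat \<lceil>p - 1\<rceil>"
  obtain a where a: "0 < a" "a < 1" and p: "p = real l + a"
    using nonnatural_real_decomp[OF assms(3,4)] by (auto simp: l_def)
  note X = assms(2) and pos = assms(5)[unfolded p]
  let ?moment = "integrable M (\<lambda>\<omega>. \<bar>X \<omega>\<bar> ^ l)"
  let ?limit = "((\<lambda>v. Gamma (p + 1) / pi * (LINT t:{v..}|lborel. inversion_integrand a l M X t))
      \<longlongrightarrow> (\<integral>\<omega>. max 0 (X \<omega>) powr p \<partial>M)) (at_right 0)"
  let ?tail = "(\<lambda>x. measure M {\<omega> \<in> space M. x < max 0 (- X \<omega>)}) \<in> o[at_top](\<lambda>x. x powr (- p))"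
  have neg: "(\<lambda>\<omega>. max 0 (- X \<omega>)) \<in> borel_measurable M" "0 \<le> max 0 (- X \<omega>)" for \<omega>
    using X by auto
  have "?tail \<longleftrightarrow> ?limit" if ?moment
    using inversion_limit_iff_weighted_moment_limit[OF a X pos that]
      tail_smallo_iff_tail_weight_moment[OF a neg, of l]
      integrable_tail_weight[OF a X pos _ integrable_inversion_integral[OF a(1) X that]]
    by (auto simp: p)
  moreover have "\<forall>v>0. set_integrable lborel {v..} (inversion_integrand a l M X)" if ?moment
    using set_integrable_inversion_integrand[OF a(1) X that] by blast
  moreover have ?moment if ?tail
    using integrable_abs_power_of_tail[OF a X pos] that by (simp add: p)
  ultimately have "?moment \<and>
      (\<forall>v>0. set_integrable lborel {v..} (inversion_integrand a l M X)) \<and> ?limit \<longleftrightarrow> ?tail"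
    by blast
  then show ?thesis
    unfolding inversion_integrand_def[abs_def] p[symmetric] unfolding l_def .
qed

end
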